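(* Let $\mathcal A$ be a $3$-dimensional vector space over $\mathbb K$ endowed with two Lie brackets $[\cdot,\cdot]$ and $[\cdot,\cdot]_1$ such that $[\cdot,\cdot]$ is non-unimodular, $[\cdot,\cdot]_1$ is unimodular and non-zero, and the unimodular ideal $I$ of $[\cdot,\cdot]$ is an abelian ideal of $[\cdot,\cdot]_1$ (such brackets are automatically compatible). Let $\Lambda,\Lambda_1$ be the Lie–Poisson structures on $\mathcal A^*$ associated to $[\cdot,\cdot]$ and $[\cdot,\cdot]_1$ respectively, and let $u\in\mathcal A\setminus I$. Then the Lie Poisson pair $(\Lambda,\Lambda_1)$ is generic and non-flat if and only if there exists some eigenvector of $[u,\cdot]_{1|I}$ (perhaps with complex eigenvalue, in the complexification of $I$, if $\mathbb K=\mathbb R$) that is not an eigenvector of $[u,\cdot]_{|I}$.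
   Context: $\mathbb K=\mathbb R$ or $\mathbb C$. The unimodular ideal of a Lie algebra is the set of elements $a$ with $\mathrm{tr}[a,\cdot]=0$; the bracket is unimodular if this ideal is the whole algebra. For a $3$-dimensional non-unimodular bracket it is a $2$-dimensional abelian ideal. Two Lie brackets on the same vector space are compatible if their sum is a Lie bracket. The Lie–Poisson structure on $\mathcal A^*$ of a Lie bracket $[\cdot,\cdot]$ is given by $\Lambda(a,b)=[a,b]$ for $a,b\in\mathcal A$ regarded as linear functions on $\mathcal A^*$. A Lie Poisson pair on $\mathcal A^*$ is the couple $(\Lambda,\Lambda_1)$ of Lie–Poisson structures of two compatible Lie brackets on $\mathcal A$. In dimension $3$ it is generic at a point $p$ if $(s\Lambda+t\Lambda_1)(p)\ne0$ for all $(s,t)\in\mathbb C^2\setminus\{0\}$ (complexifying in the real case); it is flat at $p$ if in some local coordinates around $p$ (smooth if $\mathbb K=\mathbb R$, holomorphic if $\mathbb K=\mathbb C$) both bi-vectors have constant coefficients. The pair is generic if it is generic at some point, and flat if it is flat at every generic point. *)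

theory Defs
  imports "HOL-Analysis.Analysis"
begin

text \<open>A vector space is a whole type with a scalar multiplication \<open>sc\<close>; brackets are curried
  binary operations on it.\<close>

definition basis :: "('k::field \<Rightarrow> 'a::ab_group_add \<Rightarrow> 'a) \<Rightarrow> 'a set \<Rightarrow> bool" where
  "basis sc B \<longleftrightarrow> \<not> module.dependent sc B \<and> module.span sc B = UNIV"

text \<open>The trace does not depend on the basis chosen.\<close>

definition endo_trace :: "('k::field \<Rightarrow> 'a::ab_group_add \<Rightarrow> 'a) \<Rightarrow> ('a \<Rightarrow> 'a) \<Rightarrow> 'k" where
  "endo_trace sc f =
     (let B = (SOME B. basis sc B) in \<Sum>b\<in>B. module.representation sc B (f b) b)"

definition lie_bracket ::
  "('k::field \<Rightarrow> 'a::ab_group_add \<Rightarrow> 'a) \<Rightarrow> ('a \<Rightarrow> 'a \<Rightarrow> 'a) \<Rightarrow> bool" where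
  "lie_bracket sc br \<longleftrightarrow>
     (\<forall>a. Vector_Spaces.linear sc sc (\<lambda>x. br a x)) \<and>
     (\<forall>a. Vector_Spaces.linear sc sc (\<lambda>x. br x a)) \<and>
     (\<forall>a. br a a = 0) \<and>
     (\<forall>a b c. br a (br b c) + br b (br c a) + br c (br a b) = 0)"

definition compatible_brackets ::
  "('k::field \<Rightarrow> 'a::ab_group_add \<Rightarrow> 'a) \<Rightarrow> ('a \<Rightarrow> 'a \<Rightarrow> 'a) \<Rightarrow> ('a \<Rightarrow> 'a \<Rightarrow> 'a) \<Rightarrow> bool" where
  "compatible_brackets sc br br1 \<longleftrightarrow> lie_bracket sc (\<lambda>a b. br a b + br1 a b)"

definition unimodular_ideal ::
  "('k::field \<Rightarrow> 'a::ab_group_add \<Rightarrow> 'a) \<Rightarrow> ('a \<Rightarrow> 'a \<Rightarrow> 'a) \<Rightarrow> 'a set" where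
  "unimodular_ideal sc br = {a. endo_trace sc (br a) = 0}"

definition unimodular ::
  "('k::field \<Rightarrow> 'a::ab_group_add \<Rightarrow> 'a) \<Rightarrow> ('a \<Rightarrow> 'a \<Rightarrow> 'a) \<Rightarrow> bool" where
  "unimodular sc br \<longleftrightarrow> unimodular_ideal sc br = UNIV"

definition abelian_ideal ::
  "('k::field \<Rightarrow> 'a::ab_group_add \<Rightarrow> 'a) \<Rightarrow> ('a \<Rightarrow> 'a \<Rightarrow> 'a) \<Rightarrow> 'a set \<Rightarrow> bool" where
  "abelian_ideal sc br I \<longleftrightarrow>
     module.subspace sc I \<and> (\<forall>a. \<forall>x\<in>I. br a x \<in> I) \<and> (\<forall>x\<in>I. \<forall>y\<in>I. br x y = 0)"

definition eigenvector_on ::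
  "('k::field \<Rightarrow> 'a::ab_group_add \<Rightarrow> 'a) \<Rightarrow> 'a set \<Rightarrow> ('a \<Rightarrow> 'a) \<Rightarrow> 'a \<Rightarrow> bool" where
  "eigenvector_on sc V T v \<longleftrightarrow> v \<in> V \<and> v \<noteq> 0 \<and> (\<exists>l. T v = sc l v)"

text \<open>The complexification of a real vector space consists of the pairs \<open>(x, y)\<close>, standing for
  \<open>x + \<i> y\<close>. A subspace \<open>V\<close> complexifies to \<open>V \<times> V\<close> and a linear map \<open>T\<close> to
  \<open>map_prod T T\<close>.\<close>

definition complexify_scale ::
  "(real \<Rightarrow> 'a::ab_group_add \<Rightarrow> 'a) \<Rightarrow> complex \<Rightarrow> 'a \<times> 'a \<Rightarrow> 'a \<times> 'a" where
  "complexify_scale sc z w =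
     (sc (Re z) (fst w) - sc (Im z) (snd w), sc (Re z) (snd w) + sc (Im z) (fst w))"

text \<open>Smooth functions on open subsets of \<open>K\<^sup>n\<close>, for \<open>K\<close> the reals or the complex numbers.
  The derivative required below is linear over \<open>K\<close>. So for real \<open>K\<close> these are the
  infinitely differentiable functions, and for complex \<open>K\<close> the infinitely
  complex-differentiable, that is, the holomorphic ones.\<close>

definition has_gradient ::
  "('k::real_normed_field ^ 'n \<Rightarrow> 'k) \<Rightarrow> 'k ^ 'n \<Rightarrow> 'k ^ 'n \<Rightarrow> bool" where
  "has_gradient f g x \<longleftrightarrow> (f has_derivative (\<lambda>h. \<Sum>i\<in>UNIV. g $ i * h $ i)) (at x)"

definition gradient :: "('k::real_normed_field ^ 'n \<Rightarrow> 'k) \<Rightarrow> 'k ^ 'n \<Rightarrow> 'k ^ 'n" where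
  "gradient f x = (THE g. has_gradient f g x)"

primrec Ck_on ::
  "nat \<Rightarrow> ('k::real_normed_field ^ 'n) set \<Rightarrow> ('k ^ 'n \<Rightarrow> 'k) \<Rightarrow> bool" where
  "Ck_on 0 U f \<longleftrightarrow> continuous_on U f"
| "Ck_on (Suc r) U f \<longleftrightarrow>
     (\<exists>g. (\<forall>x\<in>U. has_gradient f (g x) x) \<and> (\<forall>i. Ck_on r U (\<lambda>x. g x $ i)))"

definition smooth_on ::
  "('k::real_normed_field ^ 'n) set \<Rightarrow> ('k ^ 'n \<Rightarrow> 'k) \<Rightarrow> bool" where
  "smooth_on U f \<longleftrightarrow> (\<forall>r. Ck_on r U f)"

definition diffeomorphism_on ::
  "('k::real_normed_field ^ 'n) set \<Rightarrow> ('k ^ 'n \<Rightarrow> 'k ^ 'n) \<Rightarrow> bool" where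
  "diffeomorphism_on U \<phi> \<longleftrightarrow>
     open U \<and> inj_on \<phi> U \<and> open (\<phi> ` U) \<and>
     (\<forall>i. smooth_on U (\<lambda>x. \<phi> x $ i)) \<and>
     (\<forall>i. smooth_on (\<phi> ` U) (\<lambda>y. the_inv_into U \<phi> y $ i))"

definition dual_space :: "('k::field \<Rightarrow> 'a::ab_group_add \<Rightarrow> 'a) \<Rightarrow> ('a \<Rightarrow> 'k) set" where
  "dual_space sc = {p. Vector_Spaces.linear sc (*) p}"

definition ordered_basis :: "('k::field \<Rightarrow> 'a::ab_group_add \<Rightarrow> 'a) \<Rightarrow> ('n \<Rightarrow> 'a) \<Rightarrow> bool" where
  "ordered_basis sc b \<longleftrightarrow> inj b \<and> basis sc (range b)"

text \<open>A basis of the vector space gives linear coordinates on its dual. The local coordinates on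
  the dual are these followed by a diffeomorphism \<open>\<phi>\<close> between open subsets of \<open>K\<^sup>n\<close>.\<close>

definition linear_coords :: "('n::finite \<Rightarrow> 'a) \<Rightarrow> ('a \<Rightarrow> 'k) \<Rightarrow> 'k ^ 'n" where
  "linear_coords b p = (\<chi> i. p (b i))"

text \<open>The cotangent space of the dual at any point is the vector space itself, the differential of
  the linear function \<open>p \<mapsto> p a\<close> being \<open>a\<close>. The next definition is the differential at \<open>p\<close> of the
  function \<open>f \<circ> linear_coords b\<close>.\<close>

definition differential ::
  "('k::real_normed_field \<Rightarrow> 'a::ab_group_add \<Rightarrow> 'a) \<Rightarrow> ('n::finite \<Rightarrow> 'a) \<Rightarrow>
   ('k ^ 'n \<Rightarrow> 'k) \<Rightarrow> ('a \<Rightarrow> 'k) \<Rightarrow> 'a" where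
  "differential sc b f p = (\<Sum>i\<in>UNIV. sc (gradient f (linear_coords b p) $ i) (b i))"

text \<open>A bi-vector field on the dual takes a point and two covectors there.\<close>

definition lie_poisson :: "('a \<Rightarrow> 'a \<Rightarrow> 'a) \<Rightarrow> ('a \<Rightarrow> 'k) \<Rightarrow> 'a \<Rightarrow> 'a \<Rightarrow> 'k" where
  "lie_poisson br p a b = p (br a b)"

definition constant_coefficients ::
  "('k::real_normed_field \<Rightarrow> 'a::ab_group_add \<Rightarrow> 'a) \<Rightarrow> ('n::finite \<Rightarrow> 'a) \<Rightarrow>
   ('k ^ 'n) set \<Rightarrow> ('k ^ 'n \<Rightarrow> 'k ^ 'n) \<Rightarrow> (('a \<Rightarrow> 'k) \<Rightarrow> 'a \<Rightarrow> 'a \<Rightarrow> 'k) \<Rightarrow> bool" where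
  "constant_coefficients sc b U \<phi> P \<longleftrightarrow>
     (\<forall>i j. \<exists>c. \<forall>p\<in>dual_space sc. linear_coords b p \<in> U \<longrightarrow>
        P p (differential sc b (\<lambda>x. \<phi> x $ i) p) (differential sc b (\<lambda>x. \<phi> x $ j) p) = c)"

definition flat_at ::
  "('k::real_normed_field \<Rightarrow> 'a::ab_group_add \<Rightarrow> 'a) \<Rightarrow>
   (('a \<Rightarrow> 'k) \<Rightarrow> 'a \<Rightarrow> 'a \<Rightarrow> 'k) \<Rightarrow> (('a \<Rightarrow> 'k) \<Rightarrow> 'a \<Rightarrow> 'a \<Rightarrow> 'k) \<Rightarrow> ('a \<Rightarrow> 'k) \<Rightarrow> bool" where
  "flat_at sc P P1 p \<longleftrightarrow>
     (\<exists>(b :: 3 \<Rightarrow> 'a) U \<phi>.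
        ordered_basis sc b \<and> linear_coords b p \<in> U \<and> diffeomorphism_on U \<phi> \<and>
        constant_coefficients sc b U \<phi> P \<and> constant_coefficients sc b U \<phi> P1)"

text \<open>Here \<open>\<iota>\<close> is the embedding of \<open>K\<close> into the complex numbers. A complexified bi-vector is a
  complex-valued form on pairs of covectors; it vanishes iff it vanishes on those defined
  over \<open>K\<close>.\<close>

definition generic_at ::
  "('k \<Rightarrow> complex) \<Rightarrow> (('a \<Rightarrow> 'k) \<Rightarrow> 'a \<Rightarrow> 'a \<Rightarrow> 'k) \<Rightarrow>
   (('a \<Rightarrow> 'k) \<Rightarrow> 'a \<Rightarrow> 'a \<Rightarrow> 'k) \<Rightarrow> ('a \<Rightarrow> 'k) \<Rightarrow> bool" where
  "generic_at \<iota> P P1 p \<longleftrightarrow>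
     (\<forall>s t :: complex. (s, t) \<noteq> (0, 0) \<longrightarrow> (\<exists>a b. s * \<iota> (P p a b) + t * \<iota> (P1 p a b) \<noteq> 0))"

definition generic_pair ::
  "('k::field \<Rightarrow> complex) \<Rightarrow> ('k \<Rightarrow> 'a::ab_group_add \<Rightarrow> 'a) \<Rightarrow>
   (('a \<Rightarrow> 'k) \<Rightarrow> 'a \<Rightarrow> 'a \<Rightarrow> 'k) \<Rightarrow> (('a \<Rightarrow> 'k) \<Rightarrow> 'a \<Rightarrow> 'a \<Rightarrow> 'k) \<Rightarrow> bool" where
  "generic_pair \<iota> sc P P1 \<longleftrightarrow> (\<exists>p\<in>dual_space sc. generic_at \<iota> P P1 p)"

definition flat_pair ::
  "('k::real_normed_field \<Rightarrow> complex) \<Rightarrow> ('k \<Rightarrow> 'a::ab_group_add \<Rightarrow> 'a) \<Rightarrow>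
   (('a \<Rightarrow> 'k) \<Rightarrow> 'a \<Rightarrow> 'a \<Rightarrow> 'k) \<Rightarrow> (('a \<Rightarrow> 'k) \<Rightarrow> 'a \<Rightarrow> 'a \<Rightarrow> 'k) \<Rightarrow> bool" where
  "flat_pair \<iota> sc P P1 \<longleftrightarrow>
     (\<forall>p\<in>dual_space sc. generic_at \<iota> P P1 p \<longrightarrow> flat_at sc P P1 p)"

end

theory Submission
  imports Defs
begin

text \<open>
  Complete a basis \<open>e\<^sub>1, e\<^sub>2\<close> of the unimodular ideal \<open>I\<close> by \<open>u\<close>. Since \<open>I\<close> is abelian for both
  brackets, they are determined by the endomorphisms \<open>[u, \<cdot>]\<close> and \<open>[u, \<cdot>]\<^sub>1\<close> of \<open>I\<close>, whose matrices
  \<open>A\<close> and \<open>B\<close> list the images of the basis vectors as rows. Here \<open>tr A \<noteq> 0\<close>, because \<open>u \<notin> I\<close>, while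
  \<open>tr B = 0\<close> and \<open>B \<noteq> 0\<close> (\<open>adapted_frame_exists\<close>). On the dual, with coordinates \<open>q = (x, y)\<close> and \<open>z\<close>,
  the Lie-Poisson structures become \<open>\<partial>\<^sub>z \<and> X\<close> and \<open>\<partial>\<^sub>z \<and> Y\<close> for the linear plane vector fields
  \<open>X(q) = A q\<close> and \<open>Y(q) = B q\<close>. The pair is generic at a point exactly if \<open>X\<close> and \<open>Y\<close> are
  independent there, that is, if \<open>Q(q) = det (A q, B q)\<close> does not vanish.

  Contraction with the volume form turns the two bi-vectors into the plane one-forms
  \<open>\<alpha> = det (X, dq)\<close> and \<open>\<beta> = det (Y, dq)\<close>. In coordinates making both bi-vectors constant these become
  constant up to a common factor. Thus flatness means that \<open>\<alpha>\<close> and \<open>\<beta>\<close> have a common integrating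
  factor: the Jacobian determinant \<open>g\<close> of the flat coordinates makes \<open>g \<alpha>\<close> and \<open>g \<beta>\<close> closed, and
  conversely, if \<open>g \<alpha> = dh\<close> and \<open>g \<beta> = dh\<^sub>1\<close>, then \<open>h\<close>, \<open>h\<^sub>1\<close> and \<open>z / (g Q)\<close> are flat coordinates.
  As \<open>d\<alpha> = tr A dx \<and> dy\<close> and \<open>d\<beta> = 0\<close>, Cramer's rule for the two closedness equations gives
  \<open>d log g = tr A \<beta> / Q\<close>. So \<open>g\<close> exists near a generic point if and only if \<open>\<beta> / Q\<close> is closed, and
  because \<open>d\<beta> = 0\<close> this says that the derivative \<open>Y \<cdot> Q\<close> of \<open>Q\<close> along \<open>Y\<close> vanishes
  (\<open>integrating_factor_obstruction\<close>, \<open>flat_coordinates_exist\<close>). This \<open>obstruction\<close> is a quadratic form in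
  \<open>q\<close>, so it vanishes near one point only if it vanishes identically, and if it does not, then \<open>Q\<close> is
  not identically zero either. Hence the pair is generic and non-flat if and only if
  \<open>Y \<cdot> Q\<close> is not identically zero (\<open>generic_nonflat_iff_obstruction\<close>).

  It remains to recognise the obstruction on eigenvectors. Let \<open>a\<close> and \<open>b\<close> be the complexified
  endomorphisms of \<open>I\<close>, and put \<open>R(v) = det (a v, v)\<close>, which vanishes exactly on the eigenvectors of \<open>a\<close>
  and at \<open>0\<close>. Being trace-free, \<open>b\<close> satisfies \<open>b\<^sup>2 = l\<^sup>2\<close> for some complex number \<open>l\<close>, and up to sign and a
  quarter turn twice the obstruction is \<open>R((b + l) v) + R((b - l) v)\<close>. The vectors \<open>(b \<plusminus> l) v\<close> are
  eigenvectors of \<open>b\<close> or zero, and they exhaust the eigenvectors, so the obstruction vanishes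
  identically if and only if all eigenvectors of \<open>b\<close> are eigenvectors of \<open>a\<close>
  (\<open>common_eigenvectors_iff\<close>).

  The real and the holomorphic case are treated together, over a real normed field that is a
  Euclidean space. The calculus needed is symmetry of second derivatives, the Poincare lemma and
  the inverse function theorem, in terms of \<open>has_gradient\<close> and \<open>smooth_on\<close>.
\<close>

section \<open>Gradients and smooth functions\<close>

lemma has_gradient_add:
  "has_gradient f a x \<Longrightarrow> has_gradient g b x \<Longrightarrow> has_gradient (\<lambda>x. f x + g x) (a + b) x"
  unfolding has_gradient_def
  by (erule (1) has_derivative_add[THEN has_derivative_eq_rhs])
     (auto simp: algebra_simps sum.distrib)

lemma has_gradient_mult:
  "has_gradient f a x \<Longrightarrow> has_gradient g b x \<Longrightarrow>
    has_gradient (\<lambda>x. f x * g x) (\<chi> i. f x * b $ i + a $ i * g x) x"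
  unfolding has_gradient_def
  by (erule (1) has_derivative_mult[THEN has_derivative_eq_rhs])
     (auto simp: algebra_simps sum.distrib sum_distrib_left sum_distrib_right)

lemma has_gradient_const: "has_gradient (\<lambda>x. c) 0 x"
  unfolding has_gradient_def by simp

lemma has_gradient_component:
  "has_gradient (\<lambda>x::'k::real_normed_field^'n. x $ i) (axis i 1) x"
proof -
  have "((\<lambda>x::'k^'n. x $ i) has_derivative (\<lambda>h. h $ i)) (at x)"
    by (rule bounded_linear_imp_has_derivative) (rule bounded_linear_vec_nth)
  then show ?thesis
    unfolding has_gradient_def
    by (rule has_derivative_eq_rhs) (simp add: axis_def if_distrib[of "\<lambda>t. t * _"] cong: if_cong)
qed

lemma has_gradient_field_compose:
  assumes "has_gradient f a x" "(F has_field_derivative d) (at (f x))"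
  shows "has_gradient (\<lambda>x. F (f x)) (\<chi> i. d * a $ i) x"
proof -
  have "((\<lambda>x. F (f x)) has_derivative (\<lambda>h. d * (\<Sum>i\<in>UNIV. a $ i * h $ i))) (at x)"
    by (rule has_derivative_compose[OF assms(1)[unfolded has_gradient_def]])
       (use assms(2) in \<open>simp add: has_field_derivative_def mult_commute_abs\<close>)
  then show ?thesis
    unfolding has_gradient_def
    by (rule has_derivative_eq_rhs) (simp add: sum_distrib_left mult.assoc)
qed

lemma has_derivative_of_components:
  fixes \<phi> :: "'v::real_normed_vector \<Rightarrow> 'k::real_normed_field ^ 'n"
  assumes "\<And>i. ((\<lambda>x. \<phi> x $ i) has_derivative D i) F"
  shows "(\<phi> has_derivative (\<lambda>h. \<chi> i. D i h)) F"
proof -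
  have 1: "bounded_linear (axis j :: 'k \<Rightarrow> 'k^'n)" for j
    by (rule bounded_linear_intro[where K=1])
       (auto simp: vec_eq_iff axis_def norm_vec_def L2_set_def
          if_distrib[of norm] if_distrib[of "\<lambda>t. t\<^sup>2"] cong: if_cong)
  have "((\<lambda>x. \<Sum>i\<in>UNIV. axis i (\<phi> x $ i)) has_derivative (\<lambda>h. \<Sum>i\<in>UNIV. axis i (D i h))) F"
    by (intro has_derivative_sum bounded_linear.has_derivative[OF 1] assms)
  moreover have "(\<Sum>i\<in>UNIV. axis i (v i)) = (\<chi> i. v i)" for v :: "'n \<Rightarrow> 'k"
    by (simp add: vec_eq_iff axis_def sum.delta)
  ultimately show ?thesis by simp
qed

lemma has_gradient_vec_compose:
  fixes \<psi> :: "'k::real_normed_field ^ 'm \<Rightarrow> 'k ^ 'n"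
  assumes f: "has_gradient f a (\<psi> x)" and \<psi>: "\<And>i. has_gradient (\<lambda>x. \<psi> x $ i) (J i) x"
  shows "has_gradient (\<lambda>x. f (\<psi> x)) (\<chi> j. \<Sum>i\<in>UNIV. a $ i * J i $ j) x"
proof -
  have "(\<psi> has_derivative (\<lambda>h. \<chi> i. \<Sum>j\<in>UNIV. J i $ j * h $ j)) (at x)"
    by (rule has_derivative_of_components) (use \<psi> in \<open>simp add: has_gradient_def\<close>)
  from has_derivative_compose[OF this f[unfolded has_gradient_def]]
  show ?thesis
    unfolding has_gradient_def
    by (rule has_derivative_eq_rhs)
       (simp add: sum_distrib_left sum_distrib_right mult.assoc fun_eq_iff, subst sum.swap, rule allI, simp)
qed

lemma has_gradient_unique:
  assumes "has_gradient f a x" "has_gradient f b x"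
  shows "a = b"
proof -
  have "(\<lambda>h. \<Sum>i\<in>UNIV. a $ i * h $ i) = (\<lambda>h. \<Sum>i\<in>UNIV. b $ i * h $ i)"
    using assms unfolding has_gradient_def by (rule has_derivative_unique)
  then have *: "(\<Sum>i\<in>UNIV. a $ i * axis j 1 $ i) = (\<Sum>i\<in>UNIV. b $ i * axis j 1 $ i)" for j
    by metis
  have "a $ j = b $ j" for j
    using *[of j] by (simp add: axis_def if_distrib[of "\<lambda>t. _ * t"] cong: if_cong)
  then show ?thesis by (simp add: vec_eq_iff)
qed

lemma gradient_eq: "has_gradient f a x \<Longrightarrow> gradient f x = a"
  unfolding gradient_def using has_gradient_unique by blast

lemma has_gradient_cong_open:
  assumes "has_gradient f a x" "open U" "x \<in> U" "\<And>y. y \<in> U \<Longrightarrow> f y = g y"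
  shows "has_gradient g a x"
  using assms unfolding has_gradient_def
  by (meson has_derivative_transform_within_open)

lemma has_gradient_eq: "has_gradient f a x \<Longrightarrow> (\<And>i. a $ i = b $ i) \<Longrightarrow> has_gradient f b x"
  by (metis vec_eq_iff)

lemma Ck_on_Suc_imp: "Ck_on (Suc r) U f \<Longrightarrow> Ck_on r U f"
proof (induction r arbitrary: f)
  case 0
  then show ?case
    by (fastforce simp: has_gradient_def intro!: continuous_at_imp_continuous_on dest: has_derivative_continuous)
next
  case (Suc r)
  then show ?case by (metis Ck_on.simps(2))
qed

lemma Ck_on_subset: "Ck_on r U f \<Longrightarrow> V \<subseteq> U \<Longrightarrow> Ck_on r V f"
  by (induction r arbitrary: f) (auto intro: continuous_on_subset, metis subsetD)

lemma Ck_on_cong: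
  "Ck_on r U f \<Longrightarrow> open U \<Longrightarrow> (\<And>x. x \<in> U \<Longrightarrow> f x = g x) \<Longrightarrow> Ck_on r U g"
proof (cases r)
  case (Suc n)
  assume "Ck_on r U f" "open U" "\<And>x. x \<in> U \<Longrightarrow> f x = g x"
  then show ?thesis unfolding Suc by (auto intro: has_gradient_cong_open)
qed (auto cong: continuous_on_cong)

lemma Ck_on_const: "Ck_on r U (\<lambda>x. c)"
proof (induction r arbitrary: c)
  case (Suc r)
  then show ?case by (auto intro!: exI[of _ "\<lambda>_. 0"] has_gradient_const)
qed simp

lemma Ck_on_component: "Ck_on r U (\<lambda>x. x $ i)"
  by (cases r) (auto intro!: continuous_intros exI[of _ "\<lambda>_. axis i 1"] has_gradient_component Ck_on_const)

lemma Ck_on_add: "Ck_on r U f \<Longrightarrow> Ck_on r U g \<Longrightarrow> Ck_on r U (\<lambda>x. f x + g x)"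
proof (induction r arbitrary: f g)
  case (Suc r)
  from Suc.prems obtain a b where
    "\<forall>x\<in>U. has_gradient f (a x) x" "\<And>i. Ck_on r U (\<lambda>x. a x $ i)"
    "\<forall>x\<in>U. has_gradient g (b x) x" "\<And>i. Ck_on r U (\<lambda>x. b x $ i)" by auto
  then show ?case
    using Suc.IH by (auto intro!: exI[of _ "\<lambda>x. a x + b x"] has_gradient_add)
qed (auto intro: continuous_intros)

lemma Ck_on_mult: "Ck_on r U f \<Longrightarrow> Ck_on r U g \<Longrightarrow> Ck_on r U (\<lambda>x. f x * g x)"
proof (induction r arbitrary: f g)
  case (Suc r)
  from Suc.prems obtain a b where
    ab: "\<forall>x\<in>U. has_gradient f (a x) x" "\<And>i. Ck_on r U (\<lambda>x. a x $ i)"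
    "\<forall>x\<in>U. has_gradient g (b x) x" "\<And>i. Ck_on r U (\<lambda>x. b x $ i)" by auto
  have "Ck_on r U f" "Ck_on r U g" using Suc.prems by (blast intro: Ck_on_Suc_imp)+
  then show ?case
    using ab Suc.IH
    by (auto intro!: exI[of _ "\<lambda>x. \<chi> i. f x * b x $ i + a x $ i * g x"] has_gradient_mult Ck_on_add)
qed (auto intro: continuous_intros)

lemma Ck_on_sum: "(\<And>i. i \<in> S \<Longrightarrow> Ck_on r U (f i)) \<Longrightarrow> Ck_on r U (\<lambda>x. \<Sum>i\<in>S. f i x)"
  by (induction S rule: infinite_finite_induct) (auto intro: Ck_on_const Ck_on_add)

lemma Ck_on_prod: "(\<And>i. i \<in> S \<Longrightarrow> Ck_on r U (f i)) \<Longrightarrow> Ck_on r U (\<lambda>x. \<Prod>i\<in>S. f i x)"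
  by (induction S rule: infinite_finite_induct) (auto intro: Ck_on_const Ck_on_mult)

lemma Ck_on_uminus: "Ck_on r U f \<Longrightarrow> Ck_on r U (\<lambda>x. - f x)"
  using Ck_on_mult[OF Ck_on_const[of r U "-1"], of f] by simp

lemma Ck_on_diff: "Ck_on r U f \<Longrightarrow> Ck_on r U g \<Longrightarrow> Ck_on r U (\<lambda>x. f x - g x)"
  using Ck_on_add[OF _ Ck_on_uminus, of r U f g] by simp

lemma Ck_on_inverse: "Ck_on r U f \<Longrightarrow> (\<And>x. x \<in> U \<Longrightarrow> f x \<noteq> 0) \<Longrightarrow> Ck_on r U (\<lambda>x. inverse (f x))"
proof (induction r)
  case (Suc r)
  from Suc.prems obtain a where
    a: "\<And>x. x \<in> U \<Longrightarrow> has_gradient f (a x) x" "\<And>i. Ck_on r U (\<lambda>x. a x $ i)" by auto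
  have "Ck_on r U (\<lambda>x. inverse (f x))"
    using Suc.IH Suc.prems Ck_on_Suc_imp by blast
  then have "Ck_on r U (\<lambda>x. - (inverse (f x) * inverse (f x)) * a x $ i)" for i
    by (intro Ck_on_mult Ck_on_uminus a)
  moreover have "has_gradient (\<lambda>x. inverse (f x)) (\<chi> i. - (inverse (f x) * inverse (f x)) * a x $ i) x"
    if "x \<in> U" for x
    using has_gradient_field_compose[OF a(1)[OF that] DERIV_inverse[OF Suc.prems(2)[OF that]]]
    by (simp add: power2_eq_square)
  ultimately show ?case
    by (auto intro!: exI[of _ "\<lambda>x. \<chi> i. - (inverse (f x) * inverse (f x)) * a x $ i"])
qed (auto intro: continuous_intros)

lemma Ck_on_divide:
  "Ck_on r U f \<Longrightarrow> Ck_on r U g \<Longrightarrow> (\<And>x. x \<in> U \<Longrightarrow> g x \<noteq> 0) \<Longrightarrow> Ck_on r U (\<lambda>x. f x / g x)"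
  by (simp add: divide_inverse Ck_on_mult Ck_on_inverse)

lemma Ck_on_exp:
  fixes f :: "'k::{real_normed_field,banach}^'n \<Rightarrow> 'k"
  shows "Ck_on r U f \<Longrightarrow> Ck_on r U (\<lambda>x. exp (f x))"
proof (induction r)
  case (Suc r)
  from Suc.prems obtain a where
    a: "\<And>x. x \<in> U \<Longrightarrow> has_gradient f (a x) x" "\<And>i. Ck_on r U (\<lambda>x. a x $ i)" by auto
  have "Ck_on r U (\<lambda>x. exp (f x) * a x $ i)" for i
    by (intro Ck_on_mult a Suc.IH Ck_on_Suc_imp[OF Suc.prems])
  moreover have "has_gradient (\<lambda>x. exp (f x)) (\<chi> i. exp (f x) * a x $ i) x" if "x \<in> U" for x
    by (rule has_gradient_field_compose[OF a(1)[OF that] DERIV_exp])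
  ultimately show ?case by (auto intro!: exI[of _ "\<lambda>x. \<chi> i. exp (f x) * a x $ i"])
qed (auto intro: continuous_intros)

text \<open>The induction needs the chain rule with the partial derivatives of \<open>f\<close> composed with \<open>\<psi>\<close>, to which the
  hypothesis applies; hence \<open>f\<close> is arbitrary in the induction while \<open>\<psi>\<close> stays fixed.\<close>

lemma Ck_on_vec_compose:
  fixes \<psi> :: "'k::real_normed_field ^ 'm \<Rightarrow> 'k ^ 'n"
  assumes "Ck_on r V f" "\<And>i. Ck_on r U (\<lambda>x. \<psi> x $ i)" "\<And>x. x \<in> U \<Longrightarrow> \<psi> x \<in> V"
  shows "Ck_on r U (\<lambda>x. f (\<psi> x))"
  using assms(1,2)
proof (induction r arbitrary: f)
  case 0
  have "continuous_on U \<psi>"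
    using 0(2) by (simp add: continuous_on_def tendsto_vec_nth vec_tendstoI)
  then show ?case
    using 0(1) assms(3) by (auto intro: continuous_on_compose2)
next
  case (Suc r)
  from Suc.prems(1) obtain a where
    a: "\<And>x. x \<in> V \<Longrightarrow> has_gradient f (a x) x" "\<And>i. Ck_on r V (\<lambda>x. a x $ i)" by auto
  from Suc.prems(2) have "\<forall>i. \<exists>g. (\<forall>x\<in>U. has_gradient (\<lambda>x. \<psi> x $ i) (g x) x) \<and> (\<forall>j. Ck_on r U (\<lambda>x. g x $ j))"
    by simp
  then obtain J where
    J: "\<And>i x. x \<in> U \<Longrightarrow> has_gradient (\<lambda>x. \<psi> x $ i) (J i x) x" "\<And>i j. Ck_on r U (\<lambda>x. J i x $ j)"
    by metis
  have "Ck_on r U (\<lambda>x. a (\<psi> x) $ i)" for i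
    by (rule Suc.IH[OF a(2) Ck_on_Suc_imp[OF Suc.prems(2)]])
  then have "Ck_on r U (\<lambda>x. \<Sum>i\<in>UNIV. a (\<psi> x) $ i * J i x $ j)" for j
    by (intro Ck_on_sum Ck_on_mult J(2))
  moreover have "has_gradient (\<lambda>x. f (\<psi> x)) (\<chi> j. \<Sum>i\<in>UNIV. a (\<psi> x) $ i * J i x $ j) x"
    if "x \<in> U" for x
    by (rule has_gradient_vec_compose[OF a(1)[OF assms(3)[OF that]] J(1)[OF that]])
  ultimately show ?case
    by (auto intro!: exI[of _ "\<lambda>x. \<chi> j. \<Sum>i\<in>UNIV. a (\<psi> x) $ i * J i x $ j"])
qed

lemma smooth_onI_gradient:
  "(\<And>x. x \<in> U \<Longrightarrow> has_gradient f (g x) x) \<Longrightarrow> (\<And>i. smooth_on U (\<lambda>x. g x $ i)) \<Longrightarrow> smooth_on U f"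
  unfolding smooth_on_def
proof
  fix r assume *: "\<And>x. x \<in> U \<Longrightarrow> has_gradient f (g x) x" "\<And>i. \<forall>r. Ck_on r U (\<lambda>x. g x $ i)"
  then have "Ck_on (Suc r) U f" by auto
  then show "Ck_on r U f" by (rule Ck_on_Suc_imp)
qed

text \<open>Smoothness asks for some gradient at each order separately; uniqueness makes all of them equal to
  \<open>gradient f\<close>, which is therefore smooth.\<close>

lemma smooth_on_gradient:
  assumes "smooth_on U f"
  shows "x \<in> U \<Longrightarrow> has_gradient f (gradient f x) x" and "open U \<Longrightarrow> smooth_on U (\<lambda>x. gradient f x $ i)"
proof -
  have *: "\<exists>g. (\<forall>x\<in>U. has_gradient f (g x) x) \<and> (\<forall>i. Ck_on r U (\<lambda>x. g x $ i))" for r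
    using assms unfolding smooth_on_def by (metis Ck_on.simps(2))
  show "x \<in> U \<Longrightarrow> has_gradient f (gradient f x) x"
    using * gradient_eq by metis
  assume "open U"
  show "smooth_on U (\<lambda>x. gradient f x $ i)"
    unfolding smooth_on_def
  proof
    fix r
    obtain g where g: "\<forall>x\<in>U. has_gradient f (g x) x" "Ck_on r U (\<lambda>x. g x $ i)"
      using *[of r] by auto
    show "Ck_on r U (\<lambda>x. gradient f x $ i)"
      by (rule Ck_on_cong[OF g(2) \<open>open U\<close>]) (use g(1) gradient_eq in metis)
  qed
qed

lemma smooth_on_det:
  fixes M :: "'k::real_normed_field ^ 'm \<Rightarrow> 'k ^ 'n ^ 'n"
  assumes "\<And>i j. smooth_on U (\<lambda>x. M x $ i $ j)"
  shows "smooth_on U (\<lambda>x. det (M x))"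
  using assms unfolding smooth_on_def det_def
  by (auto intro!: Ck_on_sum Ck_on_prod Ck_on_mult Ck_on_const)

section \<open>Closed forms, potentials and local inverses\<close>

text \<open>The mixed second difference is, as a function of the step along \<open>w\<close>, an increment of
  \<open>t \<mapsto> F(x + s v + t w) - F(x + t w)\<close>. Its derivative is a difference of values of \<open>DF(\<cdot>) w\<close>, so
  differentiability of the latter at the single point \<open>x\<close> and the mean value inequality suffice.\<close>

lemma second_difference_estimate:
  fixes F :: "'a::real_normed_vector \<Rightarrow> 'b::real_normed_vector"
  assumes U: "open U" "x \<in> U"
    and F: "\<And>y. y \<in> U \<Longrightarrow> (F has_derivative DF y) (at y)"
    and D: "((\<lambda>y. DF y w) has_derivative D) (at x)"
    and e: "e > 0"
  shows "\<exists>d>0. \<forall>s. 0 < s \<and> s < d \<longrightarrow>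
     norm (F (x + s *\<^sub>R v + s *\<^sub>R w) - F (x + s *\<^sub>R v) - F (x + s *\<^sub>R w) + F x - (s * s) *\<^sub>R D v)
       \<le> e * (s * s)"
proof -
  define N where "N = norm v + norm w + 1"
  have N: "N > 0" by (simp add: N_def add_nonneg_pos)
  define e' where "e' = e / (2 * N)"
  have e': "e' > 0" using e N by (simp add: e'_def)
  obtain d1 where d1: "d1 > 0"
    "\<And>y. norm (y - x) < d1 \<Longrightarrow> norm (DF y w - DF x w - D (y - x)) \<le> e' * norm (y - x)"
    using D[unfolded has_derivative_at_alt] e' by metis
  interpret D: bounded_linear D using D by (rule has_derivative_bounded_linear)
  obtain d2 where d2: "d2 > 0" "ball x d2 \<subseteq> U" using U openE by blast
  define d where "d = min d1 d2 / N"
  have "d > 0" using d1 d2 N by (simp add: d_def)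
  moreover have "norm (F (x + s *\<^sub>R v + s *\<^sub>R w) - F (x + s *\<^sub>R v) - F (x + s *\<^sub>R w) + F x - (s * s) *\<^sub>R D v)
       \<le> e * (s * s)" if s: "0 < s" "s < d" for s
  proof -
    have sN: "s * N < d1" "s * N < d2" using s N by (auto simp: d_def field_simps)
    have small: "norm (a *\<^sub>R v + t *\<^sub>R w) \<le> s * N" if "0 \<le> a" "a \<le> s" "0 \<le> t" "t \<le> s" for a t
    proof -
      have "norm (a *\<^sub>R v + t *\<^sub>R w) \<le> a * norm v + t * norm w"
        using norm_triangle_ineq[of "a *\<^sub>R v" "t *\<^sub>R w"] that by simp
      also have "\<dots> \<le> s * norm v + s * norm w"
        using that by (intro add_mono mult_right_mono) auto
      also have "\<dots> \<le> s * N" using s by (simp add: N_def algebra_simps)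
      finally show ?thesis .
    qed
    have inU: "x + (a *\<^sub>R v + t *\<^sub>R w) \<in> U" if "0 \<le> a" "a \<le> s" "0 \<le> t" "t \<le> s" for a t
    proof -
      have "x + (a *\<^sub>R v + t *\<^sub>R w) \<in> ball x d2"
        using small[OF that] sN by (subst mem_ball, subst dist_commute) (simp add: dist_norm)
      then show ?thesis using d2 by blast
    qed
    have est: "norm (DF (x + (a *\<^sub>R v + t *\<^sub>R w)) w - DF x w - D (a *\<^sub>R v + t *\<^sub>R w)) \<le> e' * (s * N)"
      if "0 \<le> a" "a \<le> s" "0 \<le> t" "t \<le> s" for a t
    proof -
      have "norm (DF (x + (a *\<^sub>R v + t *\<^sub>R w)) w - DF x w - D (a *\<^sub>R v + t *\<^sub>R w))
          \<le> e' * norm (a *\<^sub>R v + t *\<^sub>R w)"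
        using d1(2)[of "x + (a *\<^sub>R v + t *\<^sub>R w)"] small[OF that] sN by simp
      also have "\<dots> \<le> e' * (s * N)" using small[OF that] e' by (intro mult_left_mono) auto
      finally show ?thesis .
    qed
    define \<psi> where "\<psi> t = F (x + (s *\<^sub>R v + t *\<^sub>R w)) - F (x + (0 *\<^sub>R v + t *\<^sub>R w)) - (t * s) *\<^sub>R D v" for t
    define \<psi>' where "\<psi>' t = DF (x + (s *\<^sub>R v + t *\<^sub>R w)) w - DF (x + (0 *\<^sub>R v + t *\<^sub>R w)) w - s *\<^sub>R D v" for t
    have "norm (\<psi> s - \<psi> 0) \<le> (2 * (e' * (s * N))) * norm (s - 0)"
    proof (rule differentiable_bound[where S = "{0..s}" and f' = "\<lambda>t h. h *\<^sub>R \<psi>' t"])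
      fix t assume t: "t \<in> {0..s}"
      have lin: "DF y (h *\<^sub>R w) = h *\<^sub>R DF y w" if "y \<in> U" for y h
        using F[OF that] by (simp add: has_derivative_linear linear_cmul)
      have c: "((\<lambda>t. F (x + (a *\<^sub>R v + t *\<^sub>R w))) has_derivative
           (\<lambda>h. h *\<^sub>R DF (x + (a *\<^sub>R v + t *\<^sub>R w)) w)) (at t within {0..s})" if a: "0 \<le> a" "a \<le> s" for a
      proof -
        have y: "x + (a *\<^sub>R v + t *\<^sub>R w) \<in> U" using inU a t by auto
        have "((\<lambda>t. x + (a *\<^sub>R v + t *\<^sub>R w)) has_derivative (\<lambda>h. h *\<^sub>R w)) (at t within {0..s})"
          by (auto intro!: derivative_eq_intros)
        from has_derivative_compose[OF this F[OF y]]
        show ?thesis by (simp add: lin[OF y])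
      qed
      show "(\<psi> has_derivative (\<lambda>h. h *\<^sub>R \<psi>' t)) (at t within {0..s})"
        unfolding \<psi>_def \<psi>'_def
        by (rule derivative_eq_intros c | use s in force)+ (auto simp: algebra_simps)
      have "\<psi>' t = (DF (x + (s *\<^sub>R v + t *\<^sub>R w)) w - DF x w - D (s *\<^sub>R v + t *\<^sub>R w))
          - (DF (x + (0 *\<^sub>R v + t *\<^sub>R w)) w - DF x w - D (0 *\<^sub>R v + t *\<^sub>R w))"
        by (simp add: \<psi>'_def D.add D.scaleR algebra_simps)
      also have "norm \<dots> \<le> e' * (s * N) + e' * (s * N)"
        by (rule order_trans[OF norm_triangle_ineq4 add_mono[OF est est]]) (use s t in auto)
      finally have le: "norm (\<psi>' t) \<le> 2 * (e' * (s * N))" unfolding mult_2 .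
      show "onorm (\<lambda>h. h *\<^sub>R \<psi>' t) \<le> 2 * (e' * (s * N))"
        by (rule onorm_le, subst mult.commute) (simp add: mult_left_mono[OF le])
    qed (use s in auto)
    also have "\<dots> = e * (s * s)" using N s by (simp add: e'_def field_simps)
    finally show ?thesis by (simp add: \<psi>_def algebra_simps)
  qed
  ultimately show ?thesis by blast
qed

text \<open>The second difference does not change when \<open>v\<close> and \<open>w\<close> are exchanged.\<close>

lemma has_second_derivative_symmetric:
  fixes F :: "'a::real_normed_vector \<Rightarrow> 'b::real_normed_vector"
  assumes U: "open U" "x \<in> U"
    and F: "\<And>y. y \<in> U \<Longrightarrow> (F has_derivative DF y) (at y)"
    and Dv: "((\<lambda>y. DF y v) has_derivative Dv) (at x)"
    and Dw: "((\<lambda>y. DF y w) has_derivative Dw) (at x)"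
  shows "Dv w = Dw v"
proof -
  have "norm (Dv w - Dw v) \<le> 0 + e" if "e > 0" for e
  proof -
    have e: "e / 2 > 0" using that by simp
    obtain d1 where d1: "d1 > 0" "\<And>s. 0 < s \<and> s < d1 \<Longrightarrow>
       norm (F (x + s *\<^sub>R v + s *\<^sub>R w) - F (x + s *\<^sub>R v) - F (x + s *\<^sub>R w) + F x - (s * s) *\<^sub>R Dw v)
       \<le> e / 2 * (s * s)"
      using second_difference_estimate[OF U F Dw e, of v] by blast
    obtain d2 where d2: "d2 > 0" "\<And>s. 0 < s \<and> s < d2 \<Longrightarrow>
       norm (F (x + s *\<^sub>R w + s *\<^sub>R v) - F (x + s *\<^sub>R w) - F (x + s *\<^sub>R v) + F x - (s * s) *\<^sub>R Dv w)
       \<le> e / 2 * (s * s)"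
      using second_difference_estimate[OF U F Dv e, of w] by blast
    define s where "s = min d1 d2 / 2"
    have s: "0 < s" "s < d1" "s < d2" using d1(1) d2(1) by (auto simp: s_def)
    have "(s * s) *\<^sub>R (Dv w - Dw v) =
      (F (x + s *\<^sub>R v + s *\<^sub>R w) - F (x + s *\<^sub>R v) - F (x + s *\<^sub>R w) + F x - (s * s) *\<^sub>R Dw v)
      - (F (x + s *\<^sub>R w + s *\<^sub>R v) - F (x + s *\<^sub>R w) - F (x + s *\<^sub>R v) + F x - (s * s) *\<^sub>R Dv w)"
      by (simp add: algebra_simps)
    also have "norm \<dots> \<le> e / 2 * (s * s) + e / 2 * (s * s)"
      by (rule order_trans[OF norm_triangle_ineq4 add_mono[OF d1(2) d2(2)]]) (use s in auto)
    finally have "(s * s) * norm (Dv w - Dw v) \<le> (s * s) * e" by (simp add: mult.commute)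
    then show ?thesis using s by simp
  qed
  then have "norm (Dv w - Dw v) \<le> 0" by (rule field_le_epsilon)
  then show ?thesis by simp
qed

lemma hessian_symmetric:
  fixes F :: "'k::real_normed_field ^ 'n \<Rightarrow> 'k"
  assumes "open U" "x \<in> U"
    and F: "\<And>y. y \<in> U \<Longrightarrow> has_gradient F (G y) y"
    and G: "has_gradient (\<lambda>y. G y $ i) a x" "has_gradient (\<lambda>y. G y $ j) b x"
  shows "a $ j = b $ i"
proof -
  have ax: "(\<Sum>k\<in>UNIV. a $ k * axis i 1 $ k) = a $ i" for a :: "'k^'n" and i
    by (simp add: axis_def if_distrib[of "\<lambda>t. _ * t"] cong: if_cong)
  have "(\<Sum>k\<in>UNIV. a $ k * axis j 1 $ k) = (\<Sum>k\<in>UNIV. b $ k * axis i 1 $ k)"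
    by (rule has_second_derivative_symmetric
          [of U x F "\<lambda>y h. \<Sum>k\<in>UNIV. G y $ k * h $ k" "axis i 1" _ "axis j 1"])
       (use assms in \<open>auto simp: has_gradient_def ax\<close>)
  then show ?thesis by (simp add: ax)
qed

text \<open>The potential is the integral of \<open>\<theta>\<close> along the segment from a base point \<open>x0\<close> to \<open>x\<close>. Differentiating
  under the integral sign and using closedness, the integrand becomes the \<open>t\<close>-derivative of
  \<open>t \<theta>(x0 + t (x - x0)) h\<close>. The segment parameter is real even over the complex numbers; linearity over
  the field comes for free, since the derivative found is \<open>\<theta>\<close>.\<close>

lemma closed_form_has_potential:
  fixes \<theta> :: "'k::{real_normed_field,euclidean_space} ^ 'n \<Rightarrow> 'k ^ 'n"
  assumes U: "open U" "convex U"
    and \<theta>: "\<And>x i. x \<in> U \<Longrightarrow> has_gradient (\<lambda>x. \<theta> x $ i) (H x i) x"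
    and cont: "\<And>i j. continuous_on U (\<lambda>x. H x i $ j)"
    and closed: "\<And>x i j. x \<in> U \<Longrightarrow> H x i $ j = H x j $ i"
  shows "\<exists>h. \<forall>x\<in>U. has_gradient h (\<theta> x) x"
proof (cases "U = {}")
  case False
  then obtain x0 where x0: "x0 \<in> U" by blast
  define c where "c x t = x0 + t *\<^sub>R (x - x0)" for x and t :: real
  have c: "c x t \<in> U" if "x \<in> U" "t \<in> {0..1}" for x t
  proof -
    have "c x t = (1 - t) *\<^sub>R x0 + t *\<^sub>R x" by (simp add: c_def algebra_simps)
    then show ?thesis using convexD_alt[OF U(2) x0 that(1)] that(2) by simp
  qed
  have contc: "continuous_on S (\<lambda>z. c (fst z) (snd z))" for S
    unfolding c_def by (intro continuous_intros)
  define f where "f x t = (\<Sum>i\<in>UNIV. \<theta> (c x t) $ i * (x - x0) $ i)" for x t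
  define D where "D x t h = (\<Sum>i\<in>UNIV. \<theta> (c x t) $ i * h $ i
      + (\<Sum>j\<in>UNIV. H (c x t) i $ j * (t *\<^sub>R h) $ j) * (x - x0) $ i)" for x t h
  have d\<theta>: "((\<lambda>x. \<theta> x $ i) has_derivative (\<lambda>h. \<Sum>j\<in>UNIV. H x i $ j * h $ j)) (at x)" if "x \<in> U" for x i
    using \<theta>[OF that] by (simp add: has_gradient_def)
  have cont\<theta>: "continuous_on U (\<lambda>x. \<theta> x $ i)" for i
    using d\<theta> by (meson continuous_at_imp_continuous_on has_derivative_continuous)
  have nth: "((\<lambda>x. g x $ i) has_derivative (\<lambda>h. g' h $ i)) F" if "(g has_derivative g') F"
    for g :: "'v::real_normed_vector \<Rightarrow> 'k^'n" and g' F i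
    by (rule bounded_linear.has_derivative[OF bounded_linear_vec_nth that])
  have df: "((\<lambda>x. f x t) has_derivative D x t) (at x within U)" if "x \<in> U" "t \<in> cbox 0 1" for x t
  proof -
    have ct: "c x t \<in> U" using that by (intro c) auto
    have 1: "((\<lambda>x. \<theta> (c x t) $ i) has_derivative (\<lambda>h. \<Sum>j\<in>UNIV. H (c x t) i $ j * (t *\<^sub>R h) $ j)) (at x within U)" for i
      by (rule has_derivative_compose[of "\<lambda>x. c x t" _ x U, OF _ d\<theta>[OF ct]])
         (auto simp: c_def intro!: derivative_eq_intros)
    have 2: "((\<lambda>x. (x - x0) $ i) has_derivative (\<lambda>h. h $ i)) (at x within U)" for i
      by (rule nth) (auto intro!: derivative_eq_intros)
    show ?thesis
      unfolding f_def D_def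
      by (rule has_derivative_sum) (rule has_derivative_mult[OF 1 2])
  qed
  have blD: "bounded_linear (D x t)" if "x \<in> U" "t \<in> cbox 0 1" for x t
    using df[OF that] by (rule has_derivative_bounded_linear)
  have contD: "continuous_on (U \<times> cbox 0 1) (\<lambda>z. D (fst z) (snd z) h)" for h
    unfolding D_def
    by (intro continuous_intros continuous_on_compose2[OF cont contc]
          continuous_on_compose2[OF cont\<theta> contc]) (auto intro: c)
  have lb: "((\<lambda>x. integral (cbox 0 1) (f x)) has_derivative
          integral (cbox 0 1) (\<lambda>t. Blinfun (D x t))) (at x within U)" if "x \<in> U" for x
  proof (rule leibniz_rule)
    show "((\<lambda>x. f x t) has_derivative blinfun_apply (Blinfun (D x t))) (at x within U)"
      if "x \<in> U" "t \<in> cbox 0 1" for x t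
      using df[OF that] blD[OF that] by (simp add: bounded_linear_Blinfun_apply)
    show "f x integrable_on cbox 0 1" if "x \<in> U" for x
    proof (rule integrable_continuous)
      have cx: "continuous_on S (c x)" for S unfolding c_def by (intro continuous_intros)
      show "continuous_on (cbox 0 1) (f x)"
        unfolding f_def
        by (intro continuous_intros continuous_on_compose2[OF cont\<theta> cx]) (auto intro: c[OF that])
    qed
    show "continuous_on (U \<times> cbox 0 1) (\<lambda>(x, t). Blinfun (D x t))"
    proof (rule continuous_on_blinfun_componentwise)
      fix h :: "'k^'n"
      show "continuous_on (U \<times> cbox 0 1) (\<lambda>z. blinfun_apply (case z of (x, t) \<Rightarrow> Blinfun (D x t)) h)"
        by (rule continuous_on_eq[OF contD[of h]]) (auto simp: bounded_linear_Blinfun_apply blD)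
    qed
  qed (use that U in auto)
  have "has_gradient (\<lambda>x. integral (cbox 0 1) (f x)) (\<theta> x) x" if x: "x \<in> U" for x
  proof -
    have pot: "blinfun_apply (integral (cbox 0 1) (\<lambda>t. Blinfun (D x t))) h = (\<Sum>i\<in>UNIV. \<theta> x $ i * h $ i)" for h
    proof -
      have contB: "continuous_on (cbox 0 1) (\<lambda>t. Blinfun (D x t))"
      proof (rule continuous_on_blinfun_componentwise)
        fix h :: "'k^'n"
        have "continuous_on (cbox 0 1) (\<lambda>t. D x t h)"
          using continuous_on_compose2[OF contD[of h], of "cbox 0 1" "\<lambda>t. (x, t)"] x
          by (force intro: continuous_intros)
        then show "continuous_on (cbox 0 1) (\<lambda>t. blinfun_apply (Blinfun (D x t)) h)"
          by (rule continuous_on_eq) (auto simp: bounded_linear_Blinfun_apply blD x)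
      qed
      have "blinfun_apply (integral (cbox 0 1) (\<lambda>t. Blinfun (D x t))) h
          = integral {0..1} (\<lambda>t. blinfun_apply (Blinfun (D x t)) h)"
        by (simp add: blinfun_apply_integral integrable_continuous[OF contB, simplified])
      also have "\<dots> = integral {0..1} (\<lambda>t. D x t h)"
        by (rule integral_cong) (simp add: bounded_linear_Blinfun_apply blD x)
      also have "\<dots> = 1 *\<^sub>R (\<Sum>i\<in>UNIV. \<theta> (c x 1) $ i * h $ i) - 0 *\<^sub>R (\<Sum>i\<in>UNIV. \<theta> (c x 0) $ i * h $ i)"
      proof (rule integral_unique, rule fundamental_theorem_of_calculus)
        fix t :: real assume t: "t \<in> {0..1}"
        have "((\<lambda>t. \<theta> (c x t) $ i) has_derivative
             (\<lambda>s. \<Sum>j\<in>UNIV. H (c x t) i $ j * (s *\<^sub>R (x - x0)) $ j)) (at t within {0..1})" for i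
          by (rule has_derivative_compose[of "c x" _ t "{0..1}", OF _ d\<theta>[OF c[OF x t]]])
             (auto simp: c_def[abs_def] intro!: derivative_eq_intros)
        then have 1: "((\<lambda>t. \<theta> (c x t) $ i) has_vector_derivative
             (\<Sum>j\<in>UNIV. H (c x t) i $ j * (x - x0) $ j)) (at t within {0..1})" for i
          unfolding has_vector_derivative_def
          by (rule has_derivative_eq_rhs) (simp add: fun_eq_iff scaleR_sum_right)
        have sw: "(\<Sum>i\<in>UNIV. (\<Sum>j\<in>UNIV. H (c x t) i $ j * (x - x0) $ j) * h $ i)
            = (\<Sum>i\<in>UNIV. (\<Sum>j\<in>UNIV. H (c x t) i $ j * h $ j) * (x - x0) $ i)"
          unfolding sum_distrib_right
          by (subst sum.swap, intro sum.cong refl)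
             (metis closed[OF c[OF x t]] mult.assoc mult.commute)
        show "((\<lambda>t. t *\<^sub>R (\<Sum>i\<in>UNIV. \<theta> (c x t) $ i * h $ i)) has_vector_derivative D x t h) (at t within {0..1})"
        proof (rule has_vector_derivative_eq_rhs)
          show "((\<lambda>t. t *\<^sub>R (\<Sum>i\<in>UNIV. \<theta> (c x t) $ i * h $ i)) has_vector_derivative
            t *\<^sub>R (\<Sum>i\<in>UNIV. (\<Sum>j\<in>UNIV. H (c x t) i $ j * (x - x0) $ j) * h $ i)
              + 1 *\<^sub>R (\<Sum>i\<in>UNIV. \<theta> (c x t) $ i * h $ i)) (at t within {0..1})"
            by (intro has_vector_derivative_scaleR has_vector_derivative_sum has_vector_derivative_mult_left 1 DERIV_ident)
          show "t *\<^sub>R (\<Sum>i\<in>UNIV. (\<Sum>j\<in>UNIV. H (c x t) i $ j * (x - x0) $ j) * h $ i)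
              + 1 *\<^sub>R (\<Sum>i\<in>UNIV. \<theta> (c x t) $ i * h $ i) = D x t h"
            unfolding sw D_def
            by (simp add: sum.distrib scaleR_sum_right sum_distrib_left sum_distrib_right)
        qed
      qed simp
      also have "\<dots> = (\<Sum>i\<in>UNIV. \<theta> x $ i * h $ i)" by (simp add: c_def)
      finally show ?thesis .
    qed
    show ?thesis
      unfolding has_gradient_def
      by (rule has_derivative_eq_rhs[OF lb[OF x, unfolded at_within_open[OF x U(1)]]])
         (intro ext pot)
  qed
  then show ?thesis by blast
qed auto

lemma smooth_on_gradient_component:
  assumes "smooth_on U f" "open U" "\<And>x. x \<in> U \<Longrightarrow> has_gradient f (g x) x"
  shows "smooth_on U (\<lambda>x. g x $ i)"
  unfolding smooth_on_def
proof
  fix r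
  have "Ck_on r U (\<lambda>x. gradient f x $ i)"
    using smooth_on_gradient(2)[OF assms(1,2)] by (simp add: smooth_on_def)
  then show "Ck_on r U (\<lambda>x. g x $ i)"
    by (rule Ck_on_cong[OF _ assms(2)]) (simp add: gradient_eq[OF assms(3)])
qed

lemma smooth_closed_form_has_potential:
  fixes \<theta> :: "'k::{real_normed_field,euclidean_space} ^ 'n \<Rightarrow> 'k ^ 'n"
  assumes U: "open U" "convex U"
    and \<theta>: "\<And>i. smooth_on U (\<lambda>x. \<theta> x $ i)"
    and H: "\<And>x i. x \<in> U \<Longrightarrow> has_gradient (\<lambda>x. \<theta> x $ i) (H x i) x"
    and closed: "\<And>x i j. x \<in> U \<Longrightarrow> H x i $ j = H x j $ i"
  obtains h where "\<And>x. x \<in> U \<Longrightarrow> has_gradient h (\<theta> x) x" "smooth_on U h"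
proof -
  have "\<exists>h. \<forall>x\<in>U. has_gradient h (\<theta> x) x"
  proof (rule closed_form_has_potential[OF U H _ closed])
    show "continuous_on U (\<lambda>x. H x i $ j)" for i j
      using smooth_on_gradient_component[OF \<theta> U(1) H] unfolding smooth_on_def
      by (metis Ck_on.simps(1))
  qed
  then obtain h where h: "\<And>x. x \<in> U \<Longrightarrow> has_gradient h (\<theta> x) x" by blast
  show thesis by (rule that[OF h smooth_onI_gradient[OF h \<theta>]])
qed

text \<open>The inverse function theorem gives a differentiable inverse. Its gradient at \<open>y\<close> is a smooth function of
  the value of the inverse at \<open>y\<close>, so each degree of differentiability yields the next one.\<close>

lemma smooth_inverse_function:
  fixes \<phi> :: "'k::{real_normed_field,euclidean_space} ^ 'n \<Rightarrow> 'k ^ 'n"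
  assumes U: "open U" "x0 \<in> U"
    and \<phi>: "\<And>k. smooth_on U (\<lambda>x. \<phi> x $ k)"
    and J: "\<And>x k. x \<in> U \<Longrightarrow> has_gradient (\<lambda>x. \<phi> x $ k) (J x $ k) x"
    and det: "det (J x0) \<noteq> 0"
  obtains V where "V \<subseteq> U" "x0 \<in> V" "diffeomorphism_on V \<phi>"
proof -
  have smJ: "smooth_on U (\<lambda>x. J x $ k $ j)" for k j
    by (rule smooth_on_gradient_component[OF \<phi> U(1) J])
  have contJ: "continuous_on U (\<lambda>x. J x $ k $ j)" for k j
    using smJ unfolding smooth_on_def by (metis Ck_on.simps(1))
  have d\<phi>: "(\<phi> has_derivative (\<lambda>h. J x *v h)) (at x)" if "x \<in> U" for x
    using has_derivative_of_components[OF J[OF that, unfolded has_gradient_def]]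
    by (simp add: matrix_vector_mult_def)
  have bl: "bounded_linear (\<lambda>h. M *v h)" for M :: "'k^'n^'n"
    by (rule linear_conv_bounded_linear[THEN iffD1], rule linearI)
       (simp_all add: matrix_vector_mult_def vec_eq_iff algebra_simps sum.distrib scaleR_sum_right)
  define f' where "f' x = Blinfun (\<lambda>h. J x *v h)" for x
  have f': "blinfun_apply (f' x) = (\<lambda>h. J x *v h)" for x
    by (simp add: f'_def bounded_linear_Blinfun_apply bl)
  have contf': "continuous_on U f'"
  proof (rule continuous_on_blinfun_componentwise)
    fix h :: "'k^'n"
    show "continuous_on U (\<lambda>x. blinfun_apply (f' x) h)"
      unfolding f' matrix_vector_mult_def by (intro continuous_intros contJ)
  qed
  obtain L where L: "L ** J x0 = mat 1"
    using det by (meson invertible_det_nz invertible_left_inverse)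
  have inv: "Blinfun (\<lambda>h. L *v h) o\<^sub>L f' x0 = id_blinfun"
    by (auto intro!: blinfun_eqI simp: f' bounded_linear_Blinfun_apply bl
          matrix_vector_mul_assoc L)
  obtain U' V g g' where g: "open U'" "U' \<subseteq> U" "x0 \<in> U'" "open V" "\<phi> x0 \<in> V" "homeomorphism U' V \<phi> g"
      "\<And>y. y \<in> V \<Longrightarrow> (g has_derivative (g' y)) (at y)"
      "\<And>y. y \<in> V \<Longrightarrow> g' y = Hilbert_Choice.inv (blinfun_apply (f'(g y)))"
      "\<And>y. y \<in> V \<Longrightarrow> bij (blinfun_apply (f'(g y)))"
    using inverse_function_theorem[of U \<phi> f' x0, OF U(1) _ contf' U(2) inv] d\<phi> f' by metis
  have gV: "g y \<in> U'" "\<phi> (g y) = y" if "y \<in> V" for y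
    using g(6) that unfolding homeomorphism_def by auto
  have img: "\<phi> ` U' = V" and g\<phi>: "g (\<phi> x) = x" if "x \<in> U'" for x
    using g(6) that unfolding homeomorphism_def by auto
  have inj: "inj_on \<phi> U'" using g\<phi> by (metis inj_onI)
  \<comment> \<open>Cramer's rule makes the entries of the inverse Jacobian rational in those of the Jacobian.\<close>
  define K where "K x k j = det (\<chi> i l. if l = k then (axis j 1 :: 'k^'n) $ i else J x $ i $ l) / det (J x)" for x k j
  have detg: "det (J (g y)) \<noteq> 0" if "y \<in> V" for y
  proof -
    have "inj (\<lambda>h. J (g y) *v h)" using g(9)[OF that] by (simp add: f' bij_def)
    then show ?thesis
      by (metis invertible_det_nz matrix_left_invertible_injective invertible_left_inverse)
  qed
  have gK: "has_gradient (\<lambda>y. g y $ k) (\<chi> j. K (g y) k j) y" if y: "y \<in> V" for y k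
  proof -
    have "J (g y) *v (\<chi> k. \<Sum>j\<in>UNIV. K (g y) k j * h $ j) = h" for h
    proof -
      have col: "J (g y) *v (\<chi> k. K (g y) k j) = axis j 1" for j
        unfolding K_def using cramer[OF detg[OF y]] by blast
      have "(J (g y) *v (\<chi> k. \<Sum>j\<in>UNIV. K (g y) k j * h $ j)) $ i
          = (\<Sum>j\<in>UNIV. (J (g y) *v (\<chi> k. K (g y) k j)) $ i * h $ j)" for i
        by (simp add: matrix_vector_mult_def sum_distrib_left sum_distrib_right mult.assoc) (rule sum.swap)
      then show ?thesis
        by (simp add: vec_eq_iff col axis_def if_distrib[of "\<lambda>t. t * _"] cong: if_cong)
    qed
    then have "g' y h = (\<chi> k. \<Sum>j\<in>UNIV. K (g y) k j * h $ j)" for h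
      using g(8,9)[OF y] by (metis (no_types, lifting) bij_inv_eq_iff f')
    then show ?thesis
      using bounded_linear.has_derivative[OF bounded_linear_vec_nth g(7)[OF y], of k]
      by (simp add: has_gradient_def)
  qed
  have smK: "smooth_on U' (\<lambda>x. K x k j)" if "\<And>x. x \<in> U' \<Longrightarrow> det (J x) \<noteq> 0" for k j
  proof -
    have J': "smooth_on U' (\<lambda>x. J x $ i $ l)" for i l
      using smJ g(2) Ck_on_subset unfolding smooth_on_def by blast
    have "smooth_on U' (\<lambda>x. det (J x))" by (intro smooth_on_det J')
    moreover have "smooth_on U' (\<lambda>x. det (\<chi> i l. if l = k then (axis j 1 :: 'k^'n) $ i else J x $ i $ l))"
    proof (rule smooth_on_det)
      fix i l
      show "smooth_on U' (\<lambda>x. (\<chi> i l. if l = k then (axis j 1 :: 'k^'n) $ i else J x $ i $ l) $ i $ l)"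
        using J' by (cases "l = k") (simp_all add: smooth_on_def Ck_on_const)
    qed
    ultimately show ?thesis
      unfolding K_def smooth_on_def using that by (auto intro!: Ck_on_divide)
  qed
  have detU': "det (J x) \<noteq> 0" if "x \<in> U'" for x
    using detg[of "\<phi> x"] g\<phi>[OF that] img[OF that] that by auto
  have Ckg: "Ck_on r V (\<lambda>y. g y $ k)" for r k
  proof (induction r arbitrary: k)
    case 0
    show ?case using gK unfolding has_gradient_def
      by (auto intro!: continuous_at_imp_continuous_on dest: has_derivative_continuous)
  next
    case (Suc r)
    have "Ck_on r V (\<lambda>y. K (g y) k j)" for j
      by (rule Ck_on_vec_compose[OF _ Suc.IH gV(1)])
         (use smK[OF detU'] in \<open>simp_all add: smooth_on_def\<close>)
    then show ?case using gK by (auto intro!: exI[of _ "\<lambda>y. \<chi> j. K (g y) k j"])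
  qed
  have V: "\<phi> ` U' = V" using img g(3) by blast
  have "smooth_on (\<phi> ` U') (\<lambda>y. the_inv_into U' \<phi> y $ k)" for k
    unfolding V smooth_on_def
  proof
    fix r
    show "Ck_on r V (\<lambda>y. the_inv_into U' \<phi> y $ k)"
      by (rule Ck_on_cong[OF Ckg[of r k] g(4)]) (metis gV inj the_inv_into_f_f)
  qed
  moreover have "smooth_on U' (\<lambda>x. \<phi> x $ k)" for k
    using \<phi> g(2) Ck_on_subset unfolding smooth_on_def by blast
  ultimately have "diffeomorphism_on U' \<phi>"
    unfolding diffeomorphism_on_def using inj g(1,4) V by auto
  then show thesis by (rule that[OF g(2,3)])
qed

section \<open>Plane linear algebra of the obstruction\<close>

definition wedge :: "'k::comm_ring_1 ^ 2 \<Rightarrow> 'k ^ 2 \<Rightarrow> 'k" where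
  "wedge u v = u $ 1 * v $ 2 - u $ 2 * v $ 1"

text \<open>As a function of \<open>q\<close> this is the function \<open>Q\<close>, whose non-vanishing is genericity.\<close>

definition det_pairing :: "'k::comm_ring_1 ^ 2 ^ 2 \<Rightarrow> 'k ^ 2 ^ 2 \<Rightarrow> 'k ^ 2 \<Rightarrow> 'k" where
  "det_pairing A B q = wedge (A *v q) (B *v q)"

text \<open>The derivative of \<open>det_pairing A B\<close> at \<open>q\<close> in the direction \<open>B q\<close>.\<close>

definition obstruction :: "'k::comm_ring_1 ^ 2 ^ 2 \<Rightarrow> 'k ^ 2 ^ 2 \<Rightarrow> 'k ^ 2 \<Rightarrow> 'k" where
  "obstruction A B q = wedge (A *v (B *v q)) (B *v q) + wedge (A *v q) (B *v (B *v q))"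

lemmas plane_simps = wedge_def matrix_vector_mult_def sum_2 trace_def det_2 transpose_def vec_eq_iff forall_2

lemma trace_zero_entry:
  fixes B :: "'k::comm_ring_1 ^ 2 ^ 2"
  assumes "trace B = 0"
  shows "B $ 2 $ 2 = - B $ 1 $ 1"
  using assms by (simp add: trace_def sum_2 eq_neg_iff_add_eq_0 add.commute)

text \<open>This is the theorem of Cayley and Hamilton in dimension two.\<close>

lemma trace_free_square:
  fixes B :: "'k::comm_ring_1 ^ 2 ^ 2"
  assumes "trace B = 0"
  shows "B *v (B *v q) = (- det B) *s q"
proof -
  have [simp]: "B $ 2 $ 2 = - B $ 1 $ 1" by (rule trace_zero_entry[OF assms])
  show ?thesis by (simp add: plane_simps algebra_simps)
qed

text \<open>Trace-free endomorphisms of the plane are the infinitesimal symmetries of the area form.\<close>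

lemma trace_free_wedge:
  fixes B :: "'k::comm_ring_1 ^ 2 ^ 2"
  assumes "trace B = 0"
  shows "wedge (B *v u) v = - wedge u (B *v v)"
proof -
  have [simp]: "B $ 2 $ 2 = - B $ 1 $ 1" by (rule trace_zero_entry[OF assms])
  show ?thesis by (simp add: plane_simps algebra_simps)
qed

lemma wedge_simps:
  "wedge (u + v) w = wedge u w + wedge v w" "wedge w (u + v) = wedge w u + wedge w v"
  "wedge (u - v) w = wedge u w - wedge v w" "wedge w (u - v) = wedge w u - wedge w v"
  "wedge (c *s u) w = c * wedge u w" "wedge w (c *s u) = c * wedge w u"
  "wedge u u = 0" "wedge 0 w = 0" "wedge w 0 = 0"
  by (simp_all add: wedge_def algebra_simps)

lemma wedge_eq_0_iff:
  fixes u v :: "'k::field ^ 2"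
  assumes "v \<noteq> 0"
  shows "wedge u v = 0 \<longleftrightarrow> (\<exists>l. u = l *s v)"
proof
  assume *: "wedge u v = 0"
  show "\<exists>l. u = l *s v"
  proof (cases "v $ 1 = 0")
    case True
    then have "v $ 2 \<noteq> 0" using assms by (simp add: vec_eq_iff forall_2)
    then show ?thesis using * True by (intro exI[of _ "u $ 2 / v $ 2"]) (simp add: plane_simps field_simps)
  next
    case False
    then show ?thesis using * by (intro exI[of _ "u $ 1 / v $ 1"]) (simp add: plane_simps field_simps)
  qed
qed (auto simp: wedge_simps)

text \<open>Write \<open>R(z) = wedge (A z) z\<close> and \<open>B\<^sup>2 = \<delta> = l0\<^sup>2\<close>. Then the obstruction is \<open>R(B z) + \<delta> R(z)\<close>, that is, half of
  \<open>R((B + l0) z) + R((B - l0) z)\<close>, and \<open>(B \<plusminus> l0) z\<close> are zero or eigenvectors of \<open>B\<close>. In the other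
  direction, on an eigenvector the obstruction is \<open>2 \<delta> R(z)\<close>, which settles the case \<open>\<delta> \<noteq> 0\<close>.\<close>

lemma common_eigenvectors_iff:
  fixes A B :: "complex ^ 2 ^ 2"
  assumes tr: "trace B = 0" and B: "B \<noteq> 0"
  shows "(\<forall>z l. z \<noteq> 0 \<and> B *v z = l *s z \<longrightarrow> (\<exists>m. A *v z = m *s z)) \<longleftrightarrow> (\<forall>z. obstruction A B z = 0)"
proof -
  define R where "R z = wedge (A *v z) z" for z
  define \<delta> where "\<delta> = - det B"
  have BB: "B *v (B *v z) = \<delta> *s z" for z using trace_free_square[OF tr] by (simp add: \<delta>_def)
  have ob: "obstruction A B z = R (B *v z) + \<delta> * R z" for z
    by (simp add: obstruction_def R_def BB wedge_simps)
  have R_scale: "R (c *s z) = c^2 * R z" for c z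
    by (simp add: R_def vector_scalar_commute wedge_simps power2_eq_square)
  define l0 where "l0 = csqrt \<delta>"
  have l0: "l0 * l0 = \<delta>" by (simp add: l0_def power2_eq_square[symmetric])
  show ?thesis
  proof
    assume *: "\<forall>z l. z \<noteq> 0 \<and> B *v z = l *s z \<longrightarrow> (\<exists>m. A *v z = m *s z)"
    have R0: "R w = 0" if "B *v w = l *s w" for w l
      using * that wedge_eq_0_iff[of w "A *v w"] by (cases "w = 0") (auto simp: R_def wedge_simps)
    show "\<forall>z. obstruction A B z = 0"
    proof
      fix z
      have "R (B *v z + l0 *s z) = 0"
        by (rule R0[of _ l0])
           (simp add: matrix_vector_right_distrib BB vector_scalar_commute vector_add_ldistrib
              vector_smult_assoc l0 add.commute)
      moreover have "R (B *v z - l0 *s z) = 0"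
        by (rule R0[of _ "- l0"])
           (simp add: matrix_vector_mult_diff_distrib BB vector_scalar_commute vector_ssub_ldistrib
              vector_smult_assoc l0)
      moreover have "R (B *v z + l0 *s z) + R (B *v z - l0 *s z) = 2 * obstruction A B z"
        by (simp add: ob R_def matrix_vector_right_distrib matrix_vector_mult_diff_distrib
              vector_scalar_commute wedge_simps l0[symmetric] algebra_simps)
      ultimately show "obstruction A B z = 0" by simp
    qed
  next
    assume ob0: "\<forall>z. obstruction A B z = 0"
    show "\<forall>z l. z \<noteq> 0 \<and> B *v z = l *s z \<longrightarrow> (\<exists>m. A *v z = m *s z)"
    proof (intro allI impI, elim conjE)
      fix z l assume z: "z \<noteq> 0" "B *v z = l *s z"
      have ll: "l\<^sup>2 = \<delta>"
        using BB[of z] z by (simp add: vector_scalar_commute vector_smult_assoc power2_eq_square)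
      have "R z = 0"
      proof (cases "\<delta> = 0")
        case False
        have "2 * \<delta> * R z = 0" using ob0[rule_format, of z] by (simp add: ob z(2) R_scale ll)
        then show ?thesis using False by simp
      next
        case True
        \<comment> \<open>Now \<open>B\<close> is nilpotent, and its kernel is its image.\<close>
        have "l = 0" using ll True by simp
        obtain v where v: "B *v v \<noteq> 0" using B by (metis matrix_eq matrix_vector_mult_0)
        have "wedge (B *v v) z = 0"
          by (simp add: trace_free_wedge[OF tr] z(2) \<open>l = 0\<close> wedge_simps)
        then obtain c where c: "B *v v = c *s z" using wedge_eq_0_iff[OF z(1)] by blast
        with v have "c \<noteq> 0" by auto
        have "c\<^sup>2 * R z = 0" using ob0[rule_format, of v] by (simp add: ob True c R_scale)
        then show ?thesis using \<open>c \<noteq> 0\<close> by simp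
      qed
      then show "\<exists>m. A *v z = m *s z" using wedge_eq_0_iff[OF z(1)] by (simp add: R_def)
    qed
  qed
qed

lemma quadratic_obstruction:
  "obstruction A B q = q $ 1 ^ 2 * obstruction A B (vector [1, 0]) + q $ 2 ^ 2 * obstruction A B (vector [0, 1])
    + q $ 1 * q $ 2 * (obstruction A B (vector [1, 1]) - obstruction A B (vector [1, 0]) - obstruction A B (vector [0, 1]))"
  by (simp add: obstruction_def plane_simps vector_2 algebra_simps power2_eq_square)

text \<open>The quarter turn conjugates a trace-free matrix into minus its transpose. It links the action on
  the dual plane, where the vector fields live, to the action on \<open>I\<close>, where the eigenvectors live.\<close>

lemma obstruction_transpose:
  assumes "trace B = 0"
  shows "obstruction (transpose A) (transpose B) (vector [q $ 2, - q $ 1]) = - obstruction A B q"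
proof -
  have [simp]: "B $ 2 $ 2 = - B $ 1 $ 1" by (rule trace_zero_entry[OF assms])
  show ?thesis by (simp add: obstruction_def plane_simps vector_2 algebra_simps)
qed

lemma obstruction_transpose_eq_0_iff:
  assumes "trace B = 0"
  shows "(\<forall>q. obstruction (transpose A) (transpose B) q = 0) \<longleftrightarrow> (\<forall>q. obstruction A B q = 0)"
proof -
  have *: "\<forall>q. obstruction A B q = 0"
    if "\<forall>q. obstruction (transpose A) (transpose B) q = 0" "trace B = 0" for A B :: "'a^2^2"
    using obstruction_transpose[OF that(2)] that(1) by (metis neg_0_equal_iff_equal)
  have "trace (transpose B) = 0" using assms by (simp add: trace_def transpose_def)
  then show ?thesis using * assms by (metis transpose_transpose)
qed

text \<open>For a quadratic form \<open>f\<close>, the second difference \<open>f (q + t v) + f (q - t v) - 2 f q\<close> is \<open>2 t\<^sup>2 f v\<close>.\<close>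

lemma obstruction_zero_of_open:
  fixes A B :: "'k::real_normed_field ^ 2 ^ 2"
  assumes "open U" "q \<in> U" "\<And>y. y \<in> U \<Longrightarrow> obstruction A B y = 0"
  shows "obstruction A B v = 0"
proof -
  have "continuous (at 0) (\<lambda>t::real. q + t *\<^sub>R v)" "continuous (at 0) (\<lambda>t::real. q - t *\<^sub>R v)"
    by (intro continuous_intros)+
  then have "\<forall>\<^sub>F t in at 0. q + t *\<^sub>R v \<in> U" "\<forall>\<^sub>F t in at 0. q - t *\<^sub>R v \<in> U"
    using assms(1,2) by (auto simp: continuous_within elim!: topological_tendstoD)
  then have "\<forall>\<^sub>F t in at (0::real). t \<noteq> 0 \<and> q + t *\<^sub>R v \<in> U \<and> q - t *\<^sub>R v \<in> U"
    by (auto simp: eventually_conj_iff eventually_at_filter)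
  then obtain t :: real where t: "t \<noteq> 0" "q + t *\<^sub>R v \<in> U" "q - t *\<^sub>R v \<in> U"
    using eventually_happens'[OF trivial_limit_at] by blast
  obtain a b c where abc: "\<And>q. obstruction A B q = q $ 1 ^ 2 * a + q $ 2 ^ 2 * b + q $ 1 * q $ 2 * c"
    using quadratic_obstruction[of A B] by blast
  have "obstruction A B (q + t *\<^sub>R v) + obstruction A B (q - t *\<^sub>R v) - 2 * obstruction A B q
      = 2 * (of_real t)\<^sup>2 * obstruction A B v"
    by (simp add: abc scaleR_conv_of_real[where 'a = 'k] power2_eq_square algebra_simps)
  then show ?thesis using t assms(2,3) by simp
qed

section \<open>Flat coordinates force the obstruction to vanish\<close>

definition base_point :: "'k ^ 3 \<Rightarrow> 'k::zero ^ 2" where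
  "base_point x = vector [x $ 1, x $ 2]"

text \<open>The one-form \<open>det (A q, dq)\<close>, as the vector of its coefficients with respect to \<open>dx\<close>, \<open>dy\<close>, \<open>dz\<close>.\<close>

definition planar_form :: "'k::comm_ring_1 ^ 2 ^ 2 \<Rightarrow> 'k ^ 3 \<Rightarrow> 'k ^ 3" where
  "planar_form A x = vector [- (A *v base_point x) $ 2, (A *v base_point x) $ 1, 0]"

text \<open>The bi-vector \<open>\<partial>\<^sub>z \<and> X\<close> with \<open>X = A q\<close>, evaluated on two covectors.\<close>

definition bivector :: "'k::comm_ring_1 ^ 2 ^ 2 \<Rightarrow> 'k ^ 3 \<Rightarrow> 'k ^ 3 \<Rightarrow> 'k ^ 3 \<Rightarrow> 'k" where
  "bivector A x D E = (D $ 3 * E $ 1 - D $ 1 * E $ 3) * (A *v base_point x) $ 1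
     + (D $ 3 * E $ 2 - D $ 2 * E $ 3) * (A *v base_point x) $ 2"

abbreviation pencil_det :: "'k::comm_ring_1 ^ 2 ^ 2 \<Rightarrow> 'k ^ 2 ^ 2 \<Rightarrow> 'k ^ 3 \<Rightarrow> 'k" where
  "pencil_det A B x \<equiv> det_pairing A B (base_point x)"

definition pencil_det_gradient :: "'k::comm_ring_1 ^ 2 ^ 2 \<Rightarrow> 'k ^ 2 ^ 2 \<Rightarrow> 'k ^ 3 \<Rightarrow> 'k ^ 3" where
  "pencil_det_gradient A B x = (let X = A *v base_point x; Y = B *v base_point x in vector
     [A $ 1 $ 1 * Y $ 2 + X $ 1 * B $ 2 $ 1 - A $ 2 $ 1 * Y $ 1 - X $ 2 * B $ 1 $ 1,
      A $ 1 $ 2 * Y $ 2 + X $ 1 * B $ 2 $ 2 - A $ 2 $ 2 * Y $ 1 - X $ 2 * B $ 1 $ 2, 0])"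

lemma has_gradient_vec3I:
  fixes f :: "'k::real_normed_field ^ 3 \<Rightarrow> 'k"
  assumes "(f has_derivative (\<lambda>h. a * h $ 1 + b * h $ 2 + c * h $ 3)) (at x)"
  shows "has_gradient f (vector [a, b, c]) x"
  using assms by (simp add: has_gradient_def sum_3)

lemma has_derivative_nth:
  "((\<lambda>x. x $ i) has_derivative (\<lambda>h. h $ i)) (at x within S)"
  by (rule bounded_linear_imp_has_derivative) (rule bounded_linear_vec_nth)

lemma planar_form_simps [simp]:
  "planar_form A x $ 1 = - (A *v base_point x) $ 2"
  "planar_form A x $ 2 = (A *v base_point x) $ 1"
  "planar_form A x $ 3 = 0"
  by (simp_all add: planar_form_def)

lemma base_point_simps:
  "(A *v base_point x) $ i = A $ i $ 1 * x $ 1 + A $ i $ 2 * x $ 2"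
  by (simp add: matrix_vector_mult_def base_point_def sum_2)

lemma has_gradient_planar_form:
  "has_gradient (\<lambda>x. planar_form A x $ 1) (vector [- A $ 2 $ 1, - A $ 2 $ 2, 0]) (x :: 'k::real_normed_field ^ 3)"
  "has_gradient (\<lambda>x. planar_form A x $ 2) (vector [A $ 1 $ 1, A $ 1 $ 2, 0]) (x :: 'k::real_normed_field ^ 3)"
  unfolding planar_form_simps base_point_simps
  by (rule has_gradient_vec3I; auto intro!: derivative_eq_intros has_derivative_nth simp: algebra_simps)+

lemma has_gradient_pencil_det:
  "has_gradient (pencil_det A B) (pencil_det_gradient A B x) (x :: 'k::real_normed_field ^ 3)"
  unfolding pencil_det_gradient_def Let_def det_pairing_def wedge_def base_point_simps
  by (rule has_gradient_vec3I) (auto intro!: derivative_eq_intros has_derivative_nth simp: algebra_simps)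

lemma pencil_det_planar_form:
  "pencil_det A B x = planar_form A x $ 1 * planar_form B x $ 2 - planar_form A x $ 2 * planar_form B x $ 1"
  by (simp add: det_pairing_def wedge_def)

lemma obstruction_pencil_det_gradient:
  "planar_form B x $ 2 * pencil_det_gradient A B x $ 1 - planar_form B x $ 1 * pencil_det_gradient A B x $ 2
    = obstruction A B (base_point x)"
  by (simp add: obstruction_def pencil_det_gradient_def Let_def plane_simps base_point_def algebra_simps)

lemma open_pencil_det_nonzero: "open {x :: 'k::real_normed_field ^ 3. pencil_det A B x \<noteq> 0}"
proof -
  have "continuous_on UNIV (pencil_det A B)"
    by (intro continuous_at_imp_continuous_on ballI
          has_derivative_continuous[OF has_gradient_pencil_det[unfolded has_gradient_def]])
  then show ?thesis by (simp add: open_Collect_neq)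
qed

text \<open>The forms \<open>g \<alpha>\<close> and \<open>g \<beta>\<close> are closed, as they have the potentials \<open>h\<close> and \<open>h1\<close>. These are two linear equations
  for the partial derivatives of \<open>g\<close>, with determinant \<open>Q\<close> and solution \<open>g tr A \<beta> / Q\<close>. Symmetry of the second
  derivatives of \<open>g\<close> then makes \<open>\<beta> / Q\<close> closed. Differentiability of \<open>g\<close> is enough: the formula for its
  gradient shows that it is twice differentiable.\<close>

lemma integrating_factor_obstruction:
  fixes A B :: "'k::real_normed_field ^ 2 ^ 2"
  assumes U: "open U" "x \<in> U" and Q: "pencil_det A B x \<noteq> 0"
    and trA: "trace A \<noteq> 0" and trB: "trace B = 0"
    and h: "\<And>y. y \<in> U \<Longrightarrow> has_gradient h (g y *s planar_form A y) y"
    and h1: "\<And>y. y \<in> U \<Longrightarrow> has_gradient h1 (g y *s planar_form B y) y"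
    and g: "\<And>y. y \<in> U \<Longrightarrow> has_gradient g (G y) y" and g0: "\<And>y. y \<in> U \<Longrightarrow> g y \<noteq> 0"
  shows "obstruction A B (base_point x) = 0"
proof -
  have B22: "B $ 2 $ 2 = - B $ 1 $ 1" by (rule trace_zero_entry[OF trB])
  define V where "V = U \<inter> {x. pencil_det A B x \<noteq> 0}"
  have V: "open V" "x \<in> V" using U Q open_pencil_det_nonzero by (auto simp: V_def)
  have closed: "G y $ 2 * planar_form M y $ 1 - G y $ 1 * planar_form M y $ 2 = g y * trace M"
    if y: "y \<in> U" and f: "\<And>y. y \<in> U \<Longrightarrow> has_gradient f (g y *s planar_form M y) y" for y M f
  proof -
    have "has_gradient (\<lambda>y. (g y *s planar_form M y) $ 1)
        (\<chi> i. g y * vector [- M $ 2 $ 1, - M $ 2 $ 2, 0] $ i + G y $ i * planar_form M y $ 1) y"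
      "has_gradient (\<lambda>y. (g y *s planar_form M y) $ 2)
        (\<chi> i. g y * vector [M $ 1 $ 1, M $ 1 $ 2, 0] $ i + G y $ i * planar_form M y $ 2) y"
      unfolding vector_smult_component
      by (intro has_gradient_mult g y has_gradient_planar_form)+
    from hessian_symmetric[OF U(1) y f this]
    show ?thesis by (simp add: trace_def sum_2 del: planar_form_simps) algebra
  qed
  have GA: "G y $ 2 * planar_form A y $ 1 - G y $ 1 * planar_form A y $ 2 = g y * trace A" if "y \<in> U" for y
    by (rule closed[OF that h])
  have GB: "G y $ 2 * planar_form B y $ 1 = G y $ 1 * planar_form B y $ 2" if "y \<in> U" for y
    using closed[OF that h1] by (simp add: trB)
  have G: "G y $ i = (g y * trace A) * (planar_form B y $ i * inverse (pencil_det A B y))"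
    if y: "y \<in> V" and i: "i = 1 \<or> i = 2" for y i
  proof -
    have "G y $ i * pencil_det A B y = (g y * trace A) * planar_form B y $ i"
    proof -
      have lin: "p * (a * d - b * c) = k * c" "q * (a * d - b * c) = k * d"
        if "q * a - p * b = k" "q * c = p * d" for p q a b c d k :: 'k
        using that(2) by (simp_all add: that(1)[symmetric] algebra_simps)
      show ?thesis
        using i lin[OF GA GB, of y] y unfolding pencil_det_planar_form V_def by blast
    qed
    then show ?thesis using y by (simp add: V_def field_simps)
  qed
  have grad: "has_gradient (\<lambda>y. G y $ i)
     (\<chi> j. g x * trace A * (planar_form B x $ i * (- (inverse (pencil_det A B x))\<^sup>2 * pencil_det_gradient A B x $ j)
         + b $ j * inverse (pencil_det A B x))
       + (g x * 0 $ j + G x $ j * trace A) * (planar_form B x $ i * inverse (pencil_det A B x))) x"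
    if i: "i = 1 \<or> i = 2" and b: "has_gradient (\<lambda>y. planar_form B y $ i) b x" for i b
  proof (rule has_gradient_cong_open[OF _ V])
    show "g y * trace A * (planar_form B y $ i * inverse (pencil_det A B y)) = G y $ i" if "y \<in> V" for y
      using G[OF that i] by simp
    have inv: "has_gradient (\<lambda>y. inverse (pencil_det A B y)) (\<chi> j. - (inverse (pencil_det A B x))\<^sup>2 * pencil_det_gradient A B x $ j) x"
      using has_gradient_field_compose[OF has_gradient_pencil_det DERIV_inverse[OF Q]]
      by (simp add: numeral_2_eq_2)
    show "has_gradient (\<lambda>y. g y * trace A * (planar_form B y $ i * inverse (pencil_det A B y)))
      (\<chi> j. g x * trace A * (planar_form B x $ i * (- (inverse (pencil_det A B x))\<^sup>2 * pencil_det_gradient A B x $ j)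
         + b $ j * inverse (pencil_det A B x))
       + (g x * 0 $ j + G x $ j * trace A) * (planar_form B x $ i * inverse (pencil_det A B x))) x"
      using has_gradient_mult[OF has_gradient_mult[OF g[OF U(2)] has_gradient_const]
          has_gradient_mult[OF b inv], of "trace A"]
      by simp
  qed
  have lin: "\<gamma> * r\<^sup>2 * (b2 * q1 - b1 * q2) = 0"
    if "\<gamma> * (m * r - b1 * (r\<^sup>2 * q2)) + g2 * t * (b1 * r) = \<gamma> * (m * r - b2 * (r\<^sup>2 * q1)) + g1 * t * (b2 * r)"
      and gb: "g2 * b1 = g1 * b2" for \<gamma> m r b1 b2 q1 q2 g1 g2 t :: 'k
  proof -
    have eq: "g2 * t * (b1 * r) = g1 * t * (b2 * r)"
      using arg_cong[OF gb, of "\<lambda>s. s * (t * r)"] by (simp only: mult_ac)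
    have "\<gamma> * (m * r - b1 * (r\<^sup>2 * q2)) = \<gamma> * (m * r - b2 * (r\<^sup>2 * q1))"
      by (rule add_right_imp_eq[OF that(1)[unfolded eq]])
    moreover have "\<gamma> * r\<^sup>2 * (b2 * q1 - b1 * q2)
        = \<gamma> * (m * r - b1 * (r\<^sup>2 * q2)) - \<gamma> * (m * r - b2 * (r\<^sup>2 * q1))"
      by (simp add: algebra_simps)
    ultimately show ?thesis by simp
  qed
  have "(g x * trace A) * (inverse (pencil_det A B x))\<^sup>2
      * (planar_form B x $ 2 * pencil_det_gradient A B x $ 1 - planar_form B x $ 1 * pencil_det_gradient A B x $ 2) = 0"
  proof (rule lin[where m = "B $ 1 $ 1"])
    show "g x * trace A * (B $ 1 $ 1 * inverse (pencil_det A B x) -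
          planar_form B x $ 1 * ((inverse (pencil_det A B x))\<^sup>2 * pencil_det_gradient A B x $ 2)) +
        G x $ 2 * trace A * (planar_form B x $ 1 * inverse (pencil_det A B x)) =
        g x * trace A * (B $ 1 $ 1 * inverse (pencil_det A B x) -
          planar_form B x $ 2 * ((inverse (pencil_det A B x))\<^sup>2 * pencil_det_gradient A B x $ 1)) +
        G x $ 1 * trace A * (planar_form B x $ 2 * inverse (pencil_det A B x))"
      using hessian_symmetric[OF U g grad[OF _ has_gradient_planar_form(1)] grad[OF _ has_gradient_planar_form(2)]]
        B22 by (simp del: planar_form_simps)
  qed (rule GB[OF U(2)])
  then show ?thesis
    using g0[OF U(2)] trA Q by (simp add: obstruction_pencil_det_gradient del: planar_form_simps)
qed

text \<open>A matrix \<open>J\<close> carries the antisymmetric matrix with axial vector \<open>\<alpha>\<close> to the one with axial vector \<open>\<gamma>\<close>, where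
  \<open>det J \<alpha> = J\<^sup>T \<gamma>\<close>. Here \<open>\<gamma>\<close> is constant, so \<open>det J \<alpha>\<close> is the gradient of the combination of the
  coordinates \<open>\<phi> k\<close> with coefficients \<open>\<gamma>\<close>. The same factor \<open>det J\<close> serves both forms.\<close>

lemma constant_coefficients_obstruction:
  fixes A B :: "'k::real_normed_field ^ 2 ^ 2"
  assumes U: "open U" "x \<in> U" and Q: "pencil_det A B x \<noteq> 0"
    and trA: "trace A \<noteq> 0" and trB: "trace B = 0"
    and \<phi>: "\<And>k. smooth_on U (\<phi> k)" "\<And>y k. y \<in> U \<Longrightarrow> has_gradient (\<phi> k) (J y $ k) y"
    and det: "\<And>y. y \<in> U \<Longrightarrow> det (J y) \<noteq> 0"
    and c: "\<And>y i j. y \<in> U \<Longrightarrow> bivector A y (J y $ i) (J y $ j) = c i j"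
    and c1: "\<And>y i j. y \<in> U \<Longrightarrow> bivector B y (J y $ i) (J y $ j) = c1 i j"
  shows "obstruction A B q = 0"
proof -
  have smJ: "smooth_on U (\<lambda>y. J y $ k $ i)" for k i
    using \<phi> U(1) by (intro smooth_on_gradient_component)
  define g where "g y = det (J y)" for y
  have "smooth_on U g" unfolding g_def by (rule smooth_on_det) (rule smJ)
  then have g: "has_gradient g (gradient g y) y" if "y \<in> U" for y
    using smooth_on_gradient(1) that by blast
  have pot: "has_gradient (\<lambda>y. d 2 3 * \<phi> 1 y + d 3 1 * \<phi> 2 y + d 1 2 * \<phi> 3 y) (g y *s planar_form M y) y"
    if y: "y \<in> U" and d: "\<And>y i j. y \<in> U \<Longrightarrow> bivector M y (J y $ i) (J y $ j) = d i j" for M d y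
  proof (rule has_gradient_eq)
    show "has_gradient (\<lambda>y. d 2 3 * \<phi> 1 y + d 3 1 * \<phi> 2 y + d 1 2 * \<phi> 3 y)
      ((\<chi> i. d 2 3 * J y $ 1 $ i + 0 $ i * \<phi> 1 y) + (\<chi> i. d 3 1 * J y $ 2 $ i + 0 $ i * \<phi> 2 y)
        + (\<chi> i. d 1 2 * J y $ 3 $ i + 0 $ i * \<phi> 3 y)) y"
      by (intro has_gradient_add has_gradient_mult has_gradient_const \<phi>(2) y)
    show "((\<chi> i. d 2 3 * J y $ 1 $ i + 0 $ i * \<phi> 1 y) + (\<chi> i. d 3 1 * J y $ 2 $ i + 0 $ i * \<phi> 2 y)
        + (\<chi> i. d 1 2 * J y $ 3 $ i + 0 $ i * \<phi> 3 y)) $ i = (g y *s planar_form M y) $ i" for i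
      using exhaust_3[of i]
      by (auto simp: d[OF y, symmetric] bivector_def g_def det_3 algebra_simps)
  qed
  have ob: "obstruction A B (base_point y) = 0" if "y \<in> U" "pencil_det A B y \<noteq> 0" for y
    by (rule integrating_factor_obstruction[OF U(1) that trA trB pot pot g])
       (use c c1 det in \<open>auto simp: g_def\<close>)
  define W where "W = (\<lambda>q :: 'k^2. vector [q $ 1, q $ 2, x $ 3]) -` (U \<inter> {x. pencil_det A B x \<noteq> 0})"
  have "open W"
    unfolding W_def
  proof (rule open_vimage)
    have "continuous_on UNIV (\<lambda>q :: 'k^2. (vector [q $ 1, q $ 2, x $ 3] :: 'k^3) $ i)" for i
      using exhaust_3[of i] by (elim disjE; simp; intro continuous_intros)
    then show "continuous_on UNIV (\<lambda>q :: 'k^2. vector [q $ 1, q $ 2, x $ 3] :: 'k^3)"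
      by (simp add: continuous_on_def tendsto_vec_nth vec_tendstoI)
  qed (use U(1) open_pencil_det_nonzero in blast)
  moreover have "base_point x \<in> W"
  proof -
    have "(vector [base_point x $ 1, base_point x $ 2, x $ 3] :: 'k^3) = x"
      by (simp add: vec_eq_iff forall_3 base_point_def)
    then show ?thesis using U(2) Q by (simp add: W_def)
  qed
  moreover have "obstruction A B r = 0" if "r \<in> W" for r
  proof -
    have "base_point (vector [r $ 1, r $ 2, x $ 3] :: 'k^3) = r"
      by (simp add: vec_eq_iff forall_2 base_point_def)
    then show ?thesis using ob[of "vector [r $ 1, r $ 2, x $ 3]"] that by (simp add: W_def)
  qed
  ultimately show ?thesis by (rule obstruction_zero_of_open)
qed

section \<open>Construction of flat coordinates\<close>

lemma planar_closed_form_has_potential: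
  fixes p q :: "'k::{real_normed_field,euclidean_space} ^ 3 \<Rightarrow> 'k"
  assumes U: "open U" "convex U" and sm: "smooth_on U p" "smooth_on U q"
    and p: "\<And>x. x \<in> U \<Longrightarrow> has_gradient p (vector [p1 x, p2 x, 0]) x"
    and q: "\<And>x. x \<in> U \<Longrightarrow> has_gradient q (vector [q1 x, q2 x, 0]) x"
    and closed: "\<And>x. x \<in> U \<Longrightarrow> p2 x = q1 x"
  obtains h where "\<And>x. x \<in> U \<Longrightarrow> has_gradient h (vector [p x, q x, 0]) x" "smooth_on U h"
proof (rule smooth_closed_form_has_potential[OF U,
    of "\<lambda>x. vector [p x, q x, 0]"
       "\<lambda>x i. if i = 1 then vector [p1 x, p2 x, 0] else if i = 2 then vector [q1 x, q2 x, 0] else 0"])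
  fix i :: 3
  show "smooth_on U (\<lambda>x. (vector [p x, q x, 0] :: 'k^3) $ i)"
    using exhaust_3[of i] sm by (auto simp: smooth_on_def Ck_on_const)
next
  fix x and i :: 3 assume "x \<in> U"
  then show "has_gradient (\<lambda>x. (vector [p x, q x, 0] :: 'k^3) $ i)
      (if i = 1 then vector [p1 x, p2 x, 0] else if i = 2 then vector [q1 x, q2 x, 0] else 0) x"
    using exhaust_3[of i] p q by (auto simp: has_gradient_const)
next
  fix x and i j :: 3 assume "x \<in> U"
  then show "(if i = 1 then vector [p1 x, p2 x, 0] else if i = 2 then vector [q1 x, q2 x, 0] else 0 :: 'k^3) $ j
    = (if j = 1 then vector [p1 x, p2 x, 0] else if j = 2 then vector [q1 x, q2 x, 0] else 0 :: 'k^3) $ i"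
    using exhaust_3[of i] exhaust_3[of j] closed by auto
qed (use that in blast)

lemma smooth_on_linear_part:
  fixes A :: "'k::real_normed_field ^ 2 ^ 2"
  shows "smooth_on U (\<lambda>x. (A *v base_point x) $ i)"
  unfolding base_point_simps smooth_on_def
  by (intro allI Ck_on_add Ck_on_mult Ck_on_const Ck_on_component)

lemma smooth_on_pencil_det:
  fixes A :: "'k::real_normed_field ^ 2 ^ 2"
  shows "smooth_on U (pencil_det A B)"
  unfolding det_pairing_def wedge_def
  using smooth_on_linear_part[of U A] smooth_on_linear_part[of U B] unfolding smooth_on_def
  by (intro allI Ck_on_diff Ck_on_mult) auto

lemma has_gradient_mult_planar:
  fixes f g :: "'k::real_normed_field ^ 3 \<Rightarrow> 'k"
  assumes "has_gradient f (vector [f1, f2, 0]) x" "has_gradient g (vector [g1, g2, 0]) x"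
  shows "has_gradient (\<lambda>x. f x * g x) (vector [f x * g1 + f1 * g x, f x * g2 + f2 * g x, 0]) x"
proof (rule has_gradient_eq[OF has_gradient_mult[OF assms]])
  show "(\<chi> i. f x * vector [g1, g2, 0] $ i + vector [f1, f2, 0] $ i * g x) $ i
    = (vector [f x * g1 + f1 * g x, f x * g2 + f2 * g x, 0] :: 'k^3) $ i" for i :: 3
    using exhaust_3[of i] by auto
qed

lemma has_gradient_compose_planar:
  fixes f :: "'k::real_normed_field ^ 3 \<Rightarrow> 'k"
  assumes "has_gradient f (vector [f1, f2, 0]) x" "(F has_field_derivative d) (at (f x))"
  shows "has_gradient (\<lambda>x. F (f x)) (vector [d * f1, d * f2, 0]) x"
proof (rule has_gradient_eq[OF has_gradient_field_compose[OF assms]])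
  show "(\<chi> i. d * vector [f1, f2, 0] $ i) $ i = (vector [d * f1, d * f2, 0] :: 'k^3) $ i" for i :: 3
    using exhaust_3[of i] by auto
qed

text \<open>A potential \<open>lg\<close> of the closed form \<open>tr A \<beta> / Q\<close> gives the integrating factor \<open>g = exp lg\<close>, and then potentials
  \<open>h\<close> and \<open>h1\<close> of \<open>g \<alpha>\<close> and \<open>g \<beta>\<close>. The bracket of \<open>h\<close> and \<open>h1\<close> vanishes for both structures, since neither depends
  on \<open>z\<close>. The third coordinate \<open>w z\<close> has brackets \<open>0\<close> and \<open>- w g Q\<close> with them for the first structure, and \<open>w g Q\<close>
  and \<open>0\<close> for the second one; hence the choice \<open>w = 1 / (g Q)\<close>. The Jacobian determinant is then \<open>g\<close>.\<close>

lemma flat_coordinates_exist: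
  fixes A B :: "'k::{real_normed_field,euclidean_space} ^ 2 ^ 2"
  assumes Q: "pencil_det A B x0 \<noteq> 0" and trB: "trace B = 0"
    and ob: "\<And>q. obstruction A B q = 0"
  obtains V \<phi> J where "x0 \<in> V" "diffeomorphism_on V \<phi>"
    "\<And>x k. x \<in> V \<Longrightarrow> has_gradient (\<lambda>x. \<phi> x $ k) (J x $ k) x"
    "\<And>i j. \<exists>c. \<forall>x\<in>V. bivector A x (J x $ i) (J x $ j) = c"
    "\<And>i j. \<exists>c. \<forall>x\<in>V. bivector B x (J x $ i) (J x $ j) = c"
proof -
  have B22: "B $ 2 $ 2 = - B $ 1 $ 1" by (rule trace_zero_entry[OF trB])
  define \<kappa> where "\<kappa> = trace A"
  obtain r where r: "r > 0" "ball x0 r \<subseteq> {x. pencil_det A B x \<noteq> 0}"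
    using openE[OF open_pencil_det_nonzero, of x0 A B] Q by auto
  define U where "U = ball x0 r"
  have U: "open U" "convex U" "x0 \<in> U" using r by (auto simp: U_def)
  have QU: "pencil_det A B x \<noteq> 0" if "x \<in> U" for x using r that by (auto simp: U_def)
  note [simp del] = planar_form_simps
  define \<alpha>1 \<alpha>2 \<beta>1 \<beta>2 where "\<alpha>1 = (\<lambda>x. planar_form A x $ 1)" and "\<alpha>2 = (\<lambda>x. planar_form A x $ 2)"
    and "\<beta>1 = (\<lambda>x. planar_form B x $ 1)" and "\<beta>2 = (\<lambda>x. planar_form B x $ 2)"
  note fdefs = \<alpha>1_def \<alpha>2_def \<beta>1_def \<beta>2_def
  have grads: "has_gradient \<alpha>1 (vector [- A $ 2 $ 1, - A $ 2 $ 2, 0]) x"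
    "has_gradient \<alpha>2 (vector [A $ 1 $ 1, A $ 1 $ 2, 0]) x"
    "has_gradient \<beta>1 (vector [- B $ 2 $ 1, - B $ 2 $ 2, 0]) x"
    "has_gradient \<beta>2 (vector [B $ 1 $ 1, B $ 1 $ 2, 0]) x" for x
    unfolding fdefs by (rule has_gradient_planar_form)+
  have smf: "smooth_on U \<alpha>1" "smooth_on U \<alpha>2" "smooth_on U \<beta>1" "smooth_on U \<beta>2"
    using smooth_on_linear_part[of U] unfolding fdefs planar_form_simps smooth_on_def
    by (auto intro: Ck_on_uminus)
  define Q where "Q = pencil_det A B"
  have Qab: "Q x = \<alpha>1 x * \<beta>2 x - \<alpha>2 x * \<beta>1 x" for x
    unfolding Q_def fdefs by (rule pencil_det_planar_form)
  define Q1 Q2 where "Q1 x = pencil_det_gradient A B x $ 1" and "Q2 x = pencil_det_gradient A B x $ 2" for x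
  have gQ: "has_gradient Q (vector [Q1 x, Q2 x, 0]) x" for x
  proof (rule has_gradient_eq)
    show "has_gradient Q (pencil_det_gradient A B x) x" unfolding Q_def by (rule has_gradient_pencil_det)
    show "pencil_det_gradient A B x $ i = (vector [Q1 x, Q2 x, 0] :: 'k^3) $ i" for i
      using exhaust_3[of i] by (auto simp: Q1_def Q2_def pencil_det_gradient_def Let_def)
  qed
  have inv: "\<beta>2 x * Q1 x = \<beta>1 x * Q2 x" for x
    using obstruction_pencil_det_gradient[of B x A] by (simp add: ob Q1_def Q2_def fdefs)
  have QU': "Q x \<noteq> 0" if "x \<in> U" for x using QU[OF that] by (simp add: Q_def)
  define R where "R x = inverse (Q x)" for x
  have R: "R x * Q x = 1" "Q x * R x = 1" if "x \<in> U" for x using QU'[OF that] by (auto simp: R_def)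
  have smR: "smooth_on U R"
    using smooth_on_pencil_det[of U A B] QU' unfolding smooth_on_def R_def Q_def[symmetric]
    by (auto intro!: Ck_on_inverse)
  have gR: "has_gradient R (vector [- (R x)\<^sup>2 * Q1 x, - (R x)\<^sup>2 * Q2 x, 0]) x" if "x \<in> U" for x
    using has_gradient_compose_planar[OF gQ DERIV_inverse[OF QU'[OF that]]]
    unfolding R_def numeral_2_eq_2 .
  define l1 l2 where "l1 x = \<kappa> * \<beta>1 x * R x" and "l2 x = \<kappa> * \<beta>2 x * R x" for x
  have k0: "has_gradient (\<lambda>x. \<kappa>) (vector [0, 0, 0] :: 'k^3) x" for x
  proof (rule has_gradient_eq[OF has_gradient_const])
    show "(0 :: 'k^3) $ i = vector [0, 0, 0] $ i" for i
      using exhaust_3[of i] by auto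
  qed
  obtain lg where lg: "\<And>x. x \<in> U \<Longrightarrow> has_gradient lg (vector [l1 x, l2 x, 0]) x" "smooth_on U lg"
  proof (rule planar_closed_form_has_potential[OF U(1,2), of l1 l2])
    show "smooth_on U l1" "smooth_on U l2"
      using smf smR unfolding l1_def l2_def smooth_on_def
      by (auto intro!: Ck_on_mult Ck_on_const)
    show "has_gradient l1 (vector [\<kappa> * \<beta>1 x * (- (R x)\<^sup>2 * Q1 x) + (\<kappa> * - B $ 2 $ 1 + 0 * \<beta>1 x) * R x,
        \<kappa> * \<beta>1 x * (- (R x)\<^sup>2 * Q2 x) + (\<kappa> * - B $ 2 $ 2 + 0 * \<beta>1 x) * R x, 0]) x"
      "has_gradient l2 (vector [\<kappa> * \<beta>2 x * (- (R x)\<^sup>2 * Q1 x) + (\<kappa> * B $ 1 $ 1 + 0 * \<beta>2 x) * R x,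
        \<kappa> * \<beta>2 x * (- (R x)\<^sup>2 * Q2 x) + (\<kappa> * B $ 1 $ 2 + 0 * \<beta>2 x) * R x, 0]) x" if "x \<in> U" for x
      unfolding l1_def l2_def by (intro has_gradient_mult_planar k0 grads gR[OF that])+
    show "\<kappa> * \<beta>1 x * (- (R x)\<^sup>2 * Q2 x) + (\<kappa> * - B $ 2 $ 2 + 0 * \<beta>1 x) * R x =
       \<kappa> * \<beta>2 x * (- (R x)\<^sup>2 * Q1 x) + (\<kappa> * B $ 1 $ 1 + 0 * \<beta>2 x) * R x" for x
      using inv[of x] by (simp add: B22 mult.assoc mult.left_commute[of _ "(R x)\<^sup>2"])
  qed blast
  define g where "g x = exp (lg x)" for x
  have g0: "g x \<noteq> 0" for x by (simp add: g_def)
  have gg: "has_gradient g (vector [g x * l1 x, g x * l2 x, 0]) x" if "x \<in> U" for x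
    unfolding g_def by (rule has_gradient_compose_planar[OF lg(1)[OF that] DERIV_exp])
  have smg: "smooth_on U g" using lg(2) unfolding g_def smooth_on_def by (auto intro: Ck_on_exp)
  have smg_mult: "smooth_on U (\<lambda>x. g x * f x)" if "smooth_on U f" for f
    using smg that unfolding smooth_on_def by (auto intro: Ck_on_mult)
  have kap: "\<kappa> = A $ 1 $ 1 + A $ 2 $ 2" by (simp add: \<kappa>_def trace_def sum_2)
  obtain h where h: "\<And>x. x \<in> U \<Longrightarrow> has_gradient h (vector [g x * \<alpha>1 x, g x * \<alpha>2 x, 0]) x" "smooth_on U h"
  proof (rule planar_closed_form_has_potential[OF U(1,2) smg_mult[OF smf(1)] smg_mult[OF smf(2)]
        has_gradient_mult_planar[OF gg grads(1)] has_gradient_mult_planar[OF gg grads(2)]])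
    fix x assume x: "x \<in> U"
    have "l2 x * \<alpha>1 x - l1 x * \<alpha>2 x = \<kappa> * (R x * Q x)" by (simp add: l1_def l2_def Qab algebra_simps)
    then have "g x * l2 x * \<alpha>1 x - g x * l1 x * \<alpha>2 x = g x * \<kappa>"
      using R[OF x] by (metis mult.assoc mult.right_neutral right_diff_distrib)
    then show "g x * - A $ 2 $ 2 + g x * l2 x * \<alpha>1 x = g x * A $ 1 $ 1 + g x * l1 x * \<alpha>2 x"
      by (simp add: kap algebra_simps)
  qed blast+
  obtain h1 where h1: "\<And>x. x \<in> U \<Longrightarrow> has_gradient h1 (vector [g x * \<beta>1 x, g x * \<beta>2 x, 0]) x" "smooth_on U h1"
  proof (rule planar_closed_form_has_potential[OF U(1,2) smg_mult[OF smf(3)] smg_mult[OF smf(4)]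
        has_gradient_mult_planar[OF gg grads(3)] has_gradient_mult_planar[OF gg grads(4)]])
    show "g x * - B $ 2 $ 2 + g x * l2 x * \<beta>1 x = g x * B $ 1 $ 1 + g x * l1 x * \<beta>2 x" for x
      by (simp add: B22 l1_def l2_def)
  qed blast+
  define w where "w x = inverse (g x) * R x" for x
  have gw: "w x * g x * Q x = 1" if "x \<in> U" for x
  proof -
    have "w x * g x * Q x = (inverse (g x) * g x) * (R x * Q x)" by (simp add: w_def mult_ac)
    then show ?thesis using R[OF that] g0[of x] by simp
  qed
  define w1 where "w1 x = inverse (g x) * (- (R x)\<^sup>2 * Q1 x) + - (inverse (g x) ^ Suc (Suc 0)) * (g x * l1 x) * R x" for x
  define w2 where "w2 x = inverse (g x) * (- (R x)\<^sup>2 * Q2 x) + - (inverse (g x) ^ Suc (Suc 0)) * (g x * l2 x) * R x" for x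
  have gradw: "has_gradient w (vector [w1 x, w2 x, 0]) x" if "x \<in> U" for x
    using has_gradient_mult_planar[OF has_gradient_compose_planar[OF gg[OF that] DERIV_inverse[OF g0]] gR[OF that]]
    unfolding w_def w1_def w2_def .
  have smw: "smooth_on U w"
    using smg smR g0 unfolding w_def smooth_on_def by (auto intro!: Ck_on_mult Ck_on_inverse)
  define \<phi> :: "'k^3 \<Rightarrow> 'k^3" where "\<phi> x = vector [h x, h1 x, w x * x $ 3]" for x
  define J :: "'k^3 \<Rightarrow> 'k^3^3" where "J x = vector [vector [g x * \<alpha>1 x, g x * \<alpha>2 x, 0],
      vector [g x * \<beta>1 x, g x * \<beta>2 x, 0], vector [w1 x * x $ 3, w2 x * x $ 3, w x]]" for x
  have J: "has_gradient (\<lambda>x. \<phi> x $ k) (J x $ k) x" if x: "x \<in> U" for x k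
  proof -
    have "has_gradient (\<lambda>x. w x * x $ 3) (vector [w1 x * x $ 3, w2 x * x $ 3, w x]) x"
    proof (rule has_gradient_eq[OF has_gradient_mult[OF gradw[OF x] has_gradient_component]])
      show "(\<chi> i. w x * axis 3 1 $ i + vector [w1 x, w2 x, 0] $ i * x $ 3) $ i
        = (vector [w1 x * x $ 3, w2 x * x $ 3, w x] :: 'k^3) $ i" for i
        using exhaust_3[of i] by (auto simp: axis_def)
    qed
    then show ?thesis using exhaust_3[of k] h(1)[OF x] h1(1)[OF x] by (auto simp: \<phi>_def J_def)
  qed
  have sm\<phi>: "smooth_on U (\<lambda>x. \<phi> x $ k)" for k
    using exhaust_3[of k] h(2) h1(2) smw
    by (auto simp: \<phi>_def smooth_on_def intro!: Ck_on_mult[OF _ Ck_on_component])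
  have det: "det (J x) = g x" if x: "x \<in> U" for x
  proof -
    have "det (J x) = g x * (w x * g x * Q x)" by (simp add: det_3 J_def Qab algebra_simps)
    then show ?thesis by (simp add: gw[OF x])
  qed
  obtain V where V: "V \<subseteq> U" "x0 \<in> V" "diffeomorphism_on V \<phi>"
    using smooth_inverse_function[OF U(1,3) sm\<phi> J] det[OF U(3)] g0 by metis
  have biv: "bivector A x D E = \<alpha>1 x * (D $ 2 * E $ 3 - D $ 3 * E $ 2) + \<alpha>2 x * (D $ 3 * E $ 1 - D $ 1 * E $ 3)"
    "bivector B x D E = \<beta>1 x * (D $ 2 * E $ 3 - D $ 3 * E $ 2) + \<beta>2 x * (D $ 3 * E $ 1 - D $ 1 * E $ 3)" for x D E
    by (simp_all add: bivector_def planar_form_simps fdefs algebra_simps)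
  define CA CB :: "'k^3^3" where "CA = vector [vector [0, 0, 0], vector [0, 0, 1], vector [0, - 1, 0]]"
    and "CB = vector [vector [0, 0, - 1], vector [0, 0, 0], vector [1, 0, 0]]"
  have biv_CA: "bivector A x (J x $ i) (J x $ j) = (w x * g x * Q x) * CA $ i $ j" for x i j
    using exhaust_3[of i] exhaust_3[of j]
    by (elim disjE) (simp_all add: biv J_def CA_def Qab algebra_simps)
  have biv_CB: "bivector B x (J x $ i) (J x $ j) = (w x * g x * Q x) * CB $ i $ j" for x i j
    using exhaust_3[of i] exhaust_3[of j]
    by (elim disjE) (simp_all add: biv J_def CB_def Qab algebra_simps)
  show thesis
  proof (rule that[OF V(2,3), of J])
    show "has_gradient (\<lambda>x. \<phi> x $ k) (J x $ k) x" if "x \<in> V" for x k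
      using J V(1) that by auto
    show "\<exists>c. \<forall>x\<in>V. bivector A x (J x $ i) (J x $ j) = c" for i j
      using V(1) gw by (intro exI[of _ "CA $ i $ j"]) (auto simp: biv_CA)
    show "\<exists>c. \<forall>x\<in>V. bivector B x (J x $ i) (J x $ j) = c" for i j
      using V(1) gw by (intro exI[of _ "CB $ i $ j"]) (auto simp: biv_CB)
  qed
qed

section \<open>Frames, traces and the normal form of the brackets\<close>

locale frame = vector_space sc
  for sc :: "'k::field \<Rightarrow> 'a::ab_group_add \<Rightarrow> 'a" +
  fixes b :: "'n::finite \<Rightarrow> 'a"
  assumes ordered_basis: "ordered_basis sc b"
begin

definition coords :: "'a \<Rightarrow> 'k ^ 'n" where
  "coords a = (\<chi> i. representation (range b) a (b i))"

lemma inj_b: "inj b" and independent_b: "independent (range b)" and span_b: "span (range b) = UNIV"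
  using ordered_basis by (auto simp: ordered_basis_def basis_def)

lemma coords_expand: "(\<Sum>i\<in>UNIV. sc (coords a $ i) (b i)) = a"
proof -
  have "(\<Sum>v\<in>range b. sc (representation (range b) a v) v) = a"
    by (rule sum_representation_eq) (auto simp: independent_b span_b)
  then show ?thesis by (simp add: sum.reindex[OF inj_b] coords_def)
qed

lemma coords_add: "coords (x + y) = coords x + coords y"
  and coords_diff: "coords (x - y) = coords x - coords y"
  and coords_minus: "coords (- x) = - coords x"
  and coords_scale: "coords (sc c x) = c *s coords x"
  and coords_zero: "coords 0 = 0"
  and coords_sum: "coords (\<Sum>j\<in>S. f j) = (\<Sum>j\<in>S. coords (f j))"
  using independent_b
  by (simp_all add: vec_eq_iff coords_def span_b representation_add representation_diff
      representation_neg representation_scale representation_zero representation_sum)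

lemma coords_basis: "coords (b j) = axis j 1"
  using inj_b by (simp add: vec_eq_iff coords_def axis_def representation_basis[OF independent_b] inj_eq)

lemma coords_combination: "coords (\<Sum>i\<in>UNIV. sc (c $ i) (b i)) = c"
  by (simp add: vec_eq_iff coords_sum coords_scale coords_basis axis_def if_distrib[of "\<lambda>t. _ * t"] cong: if_cong)

lemma coords_eqI: "coords x = coords y \<Longrightarrow> x = y"
  by (metis coords_expand)

lemma coords_linear:
  assumes "Vector_Spaces.linear sc sc f"
  shows "coords (f a) $ k = (\<Sum>i\<in>UNIV. coords a $ i * coords (f (b i)) $ k)"
proof -
  interpret f: Vector_Spaces.linear sc sc f by fact
  have "f a = (\<Sum>i\<in>UNIV. sc (coords a $ i) (f (b i)))"
    by (subst coords_expand[of a, symmetric]) (simp add: f.sum f.scale)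
  then show ?thesis by (simp add: coords_sum coords_scale)
qed

lemma functional_coords:
  assumes "Vector_Spaces.linear sc (*) p"
  shows "p a = (\<Sum>i\<in>UNIV. coords a $ i * p (b i))"
proof -
  interpret p: Vector_Spaces.linear sc "(*)" p by fact
  show ?thesis by (subst coords_expand[of a, symmetric]) (simp add: p.sum p.scale)
qed

text \<open>The element of the dual space with given linear coordinates; it inverts \<open>linear_coords b\<close>.\<close>

definition point :: "'k ^ 'n \<Rightarrow> 'a \<Rightarrow> 'k" where
  "point x a = (\<Sum>i\<in>UNIV. coords a $ i * x $ i)"

lemma point_dual: "point x \<in> dual_space sc"
proof -
  have "vector_space ((*) :: 'k \<Rightarrow> 'k \<Rightarrow> 'k)" by unfold_locales (auto simp: algebra_simps)
  then show ?thesis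
    by (auto simp: dual_space_def Vector_Spaces.linear_iff vector_space_axioms point_def coords_add
        coords_scale algebra_simps sum.distrib sum_distrib_left)
qed

lemma linear_coords_point: "linear_coords b (point x) = x"
  by (simp add: vec_eq_iff linear_coords_def point_def coords_basis axis_def
      if_distrib[of "\<lambda>t. t * _"] cong: if_cong)

text \<open>The trace is the pairing of the two coordinate systems: \<open>f v\<close> is expanded through the frame, and the
  sum over the other basis recombines to the frame coordinates.\<close>

lemma finite_basis_trace:
  assumes "basis sc B" and f: "Vector_Spaces.linear sc sc f"
  shows "(\<Sum>v\<in>B. representation B (f v) v) = (\<Sum>i\<in>UNIV. coords (f (b i)) $ i)"
proof -
  interpret f: Vector_Spaces.linear sc sc f by fact
  have B: "independent B" "span B = UNIV" using assms(1) by (auto simp: basis_def)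
  have "card B = card (range b)"
    using dim_eq_card[OF _ B(1), of UNIV] dim_eq_card[OF _ independent_b, of UNIV]
    by (simp add: B span_b)
  moreover have "card (range b) > 0" by (simp add: card_gt_0_iff)
  ultimately have fin: "finite B" using card_gt_0_iff[of B] by simp
  have 1: "representation B (f v) v = (\<Sum>i\<in>UNIV. coords v $ i * representation B (f (b i)) v)" for v
  proof -
    have "f v = (\<Sum>i\<in>UNIV. sc (coords v $ i) (f (b i)))"
      by (subst coords_expand[of v, symmetric]) (simp add: f.sum f.scale)
    then show ?thesis by (simp add: representation_sum representation_scale B)
  qed
  have 2: "(\<Sum>v\<in>B. representation B w v * coords v $ i) = coords w $ i" for w i
  proof -
    have "(\<Sum>v\<in>B. sc (representation B w v) v) = w"
      by (rule sum_representation_eq) (auto simp: B fin)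
    from arg_cong[OF this, of coords] show ?thesis
      by (simp add: coords_sum coords_scale vec_eq_iff)
  qed
  have "(\<Sum>v\<in>B. representation B (f v) v)
      = (\<Sum>i\<in>UNIV. \<Sum>v\<in>B. representation B (f (b i)) v * coords v $ i)"
    unfolding 1 by (subst sum.swap) (simp add: mult.commute)
  then show ?thesis by (simp add: 2)
qed

lemma endo_trace_coords:
  assumes "Vector_Spaces.linear sc sc f"
  shows "endo_trace sc f = (\<Sum>i\<in>UNIV. coords (f (b i)) $ i)"
proof -
  have "basis sc (range b)" using ordered_basis by (simp add: ordered_basis_def)
  then have "basis sc (SOME B. basis sc B)" by (rule someI)
  then show ?thesis using finite_basis_trace[OF _ assms] by (simp add: endo_trace_def)
qed

lemma trace_comp_commute:
  assumes f: "Vector_Spaces.linear sc sc f" and g: "Vector_Spaces.linear sc sc g"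
  shows "(\<Sum>i\<in>UNIV. coords (f (g (b i))) $ i) = (\<Sum>i\<in>UNIV. coords (g (f (b i))) $ i)"
proof -
  have "(\<Sum>i\<in>UNIV. coords (f (g (b i))) $ i) =
     (\<Sum>i\<in>UNIV. \<Sum>j\<in>UNIV. coords (g (b i)) $ j * coords (f (b j)) $ i)"
    by (simp add: coords_linear[OF f, of "g _"])
  also have "\<dots> = (\<Sum>i\<in>UNIV. coords (g (f (b i))) $ i)"
    by (subst sum.swap) (simp add: coords_linear[OF g, of "f _"] mult.commute)
  finally show ?thesis .
qed

end

lemma lie_bracketD:
  assumes "lie_bracket sc br"
  shows "Vector_Spaces.linear sc sc (br a)" "Vector_Spaces.linear sc sc (\<lambda>x. br x a)"
    "br a a = 0" "br a c = - br c a" "br (br a c) d = br a (br c d) - br c (br a d)"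
proof -
  show lin: "Vector_Spaces.linear sc sc (br a)" "Vector_Spaces.linear sc sc (\<lambda>x. br x a)" for a
    using assms by (auto simp: lie_bracket_def)
  show alt: "br a a = 0" for a using assms by (auto simp: lie_bracket_def)
  have add: "br (x + y) z = br x z + br y z" "br z (x + y) = br z x + br z y" for x y z
    using lin by (auto simp: Vector_Spaces.linear_iff)
  show anti: "br a c = - br c a" for a c
  proof -
    have "br (a + c) (a + c) = br a c + br c a"
      by (simp add: add alt[of a] alt[of c] add.commute)
    then show ?thesis by (simp add: alt eq_neg_iff_add_eq_0)
  qed
  have zero: "br x 0 = 0" for x using add(2)[of x 0 0] by simp
  have minus: "br x (- y) = - br x y" for x y
    using add(2)[of x "- y" y] by (simp add: zero eq_neg_iff_add_eq_0)
  have "br d (br a c) = - br (br a c) d" "br c (br d a) = - br c (br a d)"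
    by (rule anti, simp only: anti[of d a] minus)
  moreover have "br a (br c d) + br c (br d a) + br d (br a c) = 0"
    using assms by (auto simp: lie_bracket_def)
  ultimately have "br a (br c d) - br c (br a d) - br (br a c) d = 0" by simp
  then show "br (br a c) d = br a (br c d) - br c (br a d)" by simp
qed

locale frame3 = frame sc b
  for sc :: "'k::field \<Rightarrow> 'a::ab_group_add \<Rightarrow> 'a" and b :: "3 \<Rightarrow> 'a"
begin

text \<open>Says that \<open>[x, y] = \<tau>(x) C y - \<tau>(y) C x\<close>, where \<open>\<tau>\<close> is the third coordinate and \<open>C\<close> kills \<open>b 3\<close> and maps
  \<open>b 1\<close> and \<open>b 2\<close> to the vectors with coordinates the rows of \<open>A\<close>.\<close>

definition bracket_matrix :: "('a \<Rightarrow> 'a \<Rightarrow> 'a) \<Rightarrow> 'k ^ 2 ^ 2 \<Rightarrow> bool" where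
  "bracket_matrix br A \<longleftrightarrow> (\<forall>x y.
     let s = coords x $ 3 * coords y $ 1 - coords x $ 1 * coords y $ 3;
         t = coords x $ 3 * coords y $ 2 - coords x $ 2 * coords y $ 3
     in coords (br x y) = vector [s * A $ 1 $ 1 + t * A $ 2 $ 1, s * A $ 1 $ 2 + t * A $ 2 $ 2, 0])"

lemma bracket_matrixI:
  assumes lie: "lie_bracket sc br" and "br (b 1) (b 2) = 0"
    and "coords (br (b 3) (b 1)) $ 3 = 0" "coords (br (b 3) (b 2)) $ 3 = 0"
  shows "bracket_matrix br (vector [vector [coords (br (b 3) (b 1)) $ 1, coords (br (b 3) (b 1)) $ 2],
      vector [coords (br (b 3) (b 2)) $ 1, coords (br (b 3) (b 2)) $ 2]])"
proof -
  note L = lie_bracketD[OF lie]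
  have "br (b 2) (b 1) = 0" using L(4)[of "b 2" "b 1"] assms(2) by simp
  moreover have "br (b 1) (b 3) = - br (b 3) (b 1)" "br (b 2) (b 3) = - br (b 3) (b 2)"
    by (rule L(4))+
  moreover have "coords (br x y) $ k =
      (\<Sum>i\<in>UNIV. coords x $ i * (\<Sum>j\<in>UNIV. coords y $ j * coords (br (b i) (b j)) $ k))" for x y k
    using coords_linear[OF L(2)[of y], of x k] coords_linear[OF L(1), of _ y k] by simp
  ultimately have ex: "coords (br x y) $ k =
      (coords x $ 3 * coords y $ 1 - coords x $ 1 * coords y $ 3) * coords (br (b 3) (b 1)) $ k
      + (coords x $ 3 * coords y $ 2 - coords x $ 2 * coords y $ 3) * coords (br (b 3) (b 2)) $ k" for x y k
    using assms(2) by (simp add: sum_3 L(3) coords_zero coords_minus algebra_simps)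
  have full: "coords (br x y) = vector
     [(coords x $ 3 * coords y $ 1 - coords x $ 1 * coords y $ 3) * coords (br (b 3) (b 1)) $ 1
      + (coords x $ 3 * coords y $ 2 - coords x $ 2 * coords y $ 3) * coords (br (b 3) (b 2)) $ 1,
      (coords x $ 3 * coords y $ 1 - coords x $ 1 * coords y $ 3) * coords (br (b 3) (b 1)) $ 2
      + (coords x $ 3 * coords y $ 2 - coords x $ 2 * coords y $ 3) * coords (br (b 3) (b 2)) $ 2, 0]" for x y
    using assms(3,4) ex[of x y] by (simp only: vec_eq_iff forall_3 vector_3) simp
  show ?thesis
    unfolding bracket_matrix_def Let_def vector_2 by (intro allI) (rule full)
qed

text \<open>The matrices add up, and a bracket \<open>\<tau>(x) C y - \<tau>(y) C x\<close>, where \<open>\<tau>\<close> vanishes on the image of \<open>C\<close>, satisfies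
  the Jacobi identity: \<open>[x, [y, z]] = \<tau>(x) (\<tau>(y) C\<^sup>2 z - \<tau>(z) C\<^sup>2 y)\<close> has cyclic sum zero.\<close>

lemma compatible_of_matrices:
  assumes lie: "lie_bracket sc br" "lie_bracket sc br1"
    and "bracket_matrix br A" "bracket_matrix br1 B"
  shows "compatible_brackets sc br br1"
  unfolding compatible_brackets_def lie_bracket_def
proof (intro conjI allI)
  note L = lie_bracketD[OF lie(1)] and L1 = lie_bracketD[OF lie(2)]
  fix a c d
  show "Vector_Spaces.linear sc sc (\<lambda>x. br a x + br1 a x)"
    using L(1)[of a] L1(1)[of a] by (auto simp: Vector_Spaces.linear_iff scale_right_distrib)
  show "Vector_Spaces.linear sc sc (\<lambda>x. br x a + br1 x a)"
    using L(2)[of a] L1(2)[of a] by (auto simp: Vector_Spaces.linear_iff scale_right_distrib)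
  show "br a a + br1 a a = 0" by (simp add: L(3) L1(3))
  define C where "C = A + B"
  define s where "s x y = coords x $ 3 * coords y $ 1 - coords x $ 1 * coords y $ 3" for x y
  define t where "t x y = coords x $ 3 * coords y $ 2 - coords x $ 2 * coords y $ 3" for x y
  define N where "N x y = br x y + br1 x y" for x y
  have N: "coords (N x y) $ 1 = s x y * C $ 1 $ 1 + t x y * C $ 2 $ 1"
    "coords (N x y) $ 2 = s x y * C $ 1 $ 2 + t x y * C $ 2 $ 2" "coords (N x y) $ 3 = 0" for x y
    using assms(3,4)
    by (simp_all add: bracket_matrix_def Let_def N_def coords_add C_def s_def t_def algebra_simps)
  have st: "s x (N y z) = coords x $ 3 * (s y z * C $ 1 $ 1 + t y z * C $ 2 $ 1)"
    "t x (N y z) = coords x $ 3 * (s y z * C $ 1 $ 2 + t y z * C $ 2 $ 2)" for x y z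
    by (simp_all add: s_def[of x "N y z"] t_def[of x "N y z"] N)
  have cyc: "coords a $ 3 * s c d + coords c $ 3 * s d a + coords d $ 3 * s a c = 0"
    "coords a $ 3 * t c d + coords c $ 3 * t d a + coords d $ 3 * t a c = 0"
    by (simp_all add: s_def t_def algebra_simps)
  have "coords (N a (N c d) + N c (N d a) + N d (N a c)) $ k = 0" for k
  proof -
    have "coords (N a (N c d) + N c (N d a) + N d (N a c)) $ 1 =
        (coords a $ 3 * s c d + coords c $ 3 * s d a + coords d $ 3 * s a c) * (C $ 1 $ 1 * C $ 1 $ 1 + C $ 1 $ 2 * C $ 2 $ 1)
      + (coords a $ 3 * t c d + coords c $ 3 * t d a + coords d $ 3 * t a c) * (C $ 2 $ 1 * C $ 1 $ 1 + C $ 2 $ 2 * C $ 2 $ 1)"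
      by (simp add: coords_add N st algebra_simps)
    moreover have "coords (N a (N c d) + N c (N d a) + N d (N a c)) $ 2 =
        (coords a $ 3 * s c d + coords c $ 3 * s d a + coords d $ 3 * s a c) * (C $ 1 $ 1 * C $ 1 $ 2 + C $ 1 $ 2 * C $ 2 $ 2)
      + (coords a $ 3 * t c d + coords c $ 3 * t d a + coords d $ 3 * t a c) * (C $ 2 $ 1 * C $ 1 $ 2 + C $ 2 $ 2 * C $ 2 $ 2)"
      by (simp add: coords_add N st algebra_simps)
    moreover have "coords (N a (N c d) + N c (N d a) + N d (N a c)) $ 3 = 0"
      by (simp add: coords_add N)
    ultimately show ?thesis using exhaust_3[of k] cyc by auto
  qed
  then have "N a (N c d) + N c (N d a) + N d (N a c) = 0"
    by (intro coords_eqI) (simp add: vec_eq_iff coords_zero)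
  then show "br a (br c d + br1 c d) + br1 a (br c d + br1 c d) + (br c (br d a + br1 d a) + br1 c (br d a + br1 d a))
     + (br d (br a c + br1 a c) + br1 d (br a c + br1 a c)) = 0"
    by (simp only: N_def)
qed

end

lemma ordered_basis3:
  assumes "vector_space sc" "distinct [e1, e2, e3]" "basis sc {e1, e2, e3}"
  shows "ordered_basis sc (\<lambda>i :: 3. if i = 1 then e1 else if i = 2 then e2 else e3)"
proof -
  have "range (\<lambda>i :: 3. if i = 1 then e1 else if i = 2 then e2 else e3) = {e1, e2, e3}"
    unfolding UNIV_3 by (simp add: insert_commute)
  moreover have "inj (\<lambda>i :: 3. if i = 1 then e1 else if i = 2 then e2 else e3)"
    unfolding inj_def using assms(2) exhaust_3 by (auto simp: forall_3)
  ultimately show ?thesis using assms(3) by (simp add: ordered_basis_def)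
qed

text \<open>The linear function \<open>\<tau>(a) = tr [a, \<cdot>]\<close> has kernel \<open>I\<close> and is not zero, so a basis of \<open>I\<close> together with \<open>u\<close> is a
  basis of the space. Brackets lie in \<open>I\<close>, since \<open>[a, c]\<close> acts as a commutator, which has trace zero. For
  the basis vectors of \<open>I\<close> the traces \<open>\<tau>(e1)\<close> and \<open>\<tau>(e2)\<close> are, up to sign, the coordinates of \<open>[e1, e2]\<close>; they
  vanish, so \<open>I\<close> is abelian.\<close>

lemma adapted_frame_exists:
  fixes sc :: "'k::field \<Rightarrow> 'a::ab_group_add \<Rightarrow> 'a"
  assumes vs: "vector_space sc" and dim: "vector_space.dim sc UNIV = 3"
    and lie: "lie_bracket sc br" "lie_bracket sc br1"
    and uni: "\<not> unimodular sc br" "unimodular sc br1" and "br1 \<noteq> (\<lambda>a b. 0)"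
    and I: "I = unimodular_ideal sc br" and ab: "abelian_ideal sc br1 I" and u: "u \<notin> I"
  obtains b :: "3 \<Rightarrow> 'a" and A B :: "'k ^ 2 ^ 2" where
    "frame3 sc b" "b 3 = u" "I = {a. frame.coords sc b a $ 3 = 0}"
    "frame3.bracket_matrix sc b br A" "frame3.bracket_matrix sc b br1 B"
    "trace A \<noteq> 0" "trace B = 0" "B \<noteq> 0"
proof -
  interpret vector_space sc by (rule vs)
  note L = lie_bracketD[OF lie(1)] and L1 = lie_bracketD[OF lie(2)]
  have subI: "subspace I" using ab by (simp add: abelian_ideal_def)
  define \<tau> where "\<tau> a = endo_trace sc (br a)" for a
  have I\<tau>: "I = {a. \<tau> a = 0}" by (simp add: I unimodular_ideal_def \<tau>_def)
  have "\<exists>B. basis sc B" using basis_exists[of UNIV] by (metis basis_def top.extremum_uniqueI)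
  then have B0: "basis sc (SOME B. basis sc B)" by (rule someI_ex)
  have \<tau>_add: "\<tau> (x + y) = \<tau> x + \<tau> y" and \<tau>_scale: "\<tau> (sc c x) = c * \<tau> x" for x y c
    using B0 L(2)
    by (simp_all add: \<tau>_def endo_trace_def Let_def basis_def Vector_Spaces.linear_iff
        representation_add representation_scale sum.distrib sum_distrib_left)
  have \<tau>u: "\<tau> u \<noteq> 0" using u I\<tau> by auto
  obtain E where E: "E \<subseteq> I" "independent E" "I \<subseteq> span E" using maximal_independent_subset by blast
  have spE: "span E = I" using E subI by (metis span_minimal subset_antisym)
  have indu: "independent (insert u E)" using E(2) spE u by (intro independent_insertI) auto
  have "a \<in> span (insert u E)" for a
  proof -
    have "\<tau> (a - sc (\<tau> a / \<tau> u) u) + \<tau> (sc (\<tau> a / \<tau> u) u) = \<tau> a" by (subst \<tau>_add[symmetric]) simp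
    then have "a - sc (\<tau> a / \<tau> u) u \<in> span E" using \<tau>u by (simp add: spE I\<tau> \<tau>_scale)
    then show ?thesis by (auto simp: span_insert)
  qed
  then have spu: "span (insert u E) = UNIV" by blast
  have card3: "card (insert u E) = 3" using dim_eq_card[OF _ indu, of UNIV] spu dim by simp
  have "u \<notin> E" using u E(1) by blast
  moreover have "finite (insert u E)" by (rule card_ge_0_finite) (simp add: card3)
  ultimately have "card E = 2" using card3 by simp
  then obtain e1 e2 where e: "E = {e1, e2}" "e1 \<noteq> e2" by (meson card_2_iff)
  define b :: "3 \<Rightarrow> 'a" where "b = (\<lambda>i. if i = 1 then e1 else if i = 2 then e2 else u)"
  have b: "b 1 = e1" "b 2 = e2" "b 3 = u" by (simp_all add: b_def)
  have "{e1, e2, u} = insert u E" using e by auto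
  then have "ordered_basis sc b"
    unfolding b_def using e \<open>u \<notin> E\<close> indu spu by (intro ordered_basis3 vs) (auto simp: basis_def)
  then interpret frame3 sc b by unfold_locales
  have eI: "e1 \<in> I" "e2 \<in> I" using E(1) e by auto
  have \<tau>_coords: "\<tau> a = coords a $ 3 * \<tau> u" for a
  proof -
    have "\<tau> (\<Sum>i\<in>UNIV. sc (coords a $ i) (b i)) = coords a $ 3 * \<tau> u"
      using eI by (simp add: sum_3 \<tau>_add \<tau>_scale b I\<tau>)
    then show ?thesis by (simp add: coords_expand)
  qed
  have I3: "I = {a. coords a $ 3 = 0}" 
  proof -
    have "a \<in> I \<longleftrightarrow> coords a $ 3 = 0" for a
      using \<tau>_coords[of a] \<tau>u by (simp add: I\<tau>)
    then show ?thesis by blast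
  qed
  have trace: "\<tau> a = (\<Sum>i\<in>UNIV. coords (br a (b i)) $ i)" for a
    unfolding \<tau>_def by (rule endo_trace_coords[OF L(1)])
  have derived: "br a c \<in> I" for a c
    using trace_comp_commute[OF L(1)[of a] L(1)[of c]]
    by (simp add: I\<tau> trace L(5) coords_diff sum_subtractf)
  have br12: "br e1 e2 = 0"
  proof (rule coords_eqI)
    have "\<tau> e1 = coords (br e1 e2) $ 2" "\<tau> e2 = coords (br e2 e1) $ 1"
      using derived[of e1 u] derived[of e2 u] by (simp_all add: trace sum_3 b L(3) I3 coords_zero)
    moreover have "coords (br e2 e1) = - coords (br e1 e2)" by (subst L(4)) (simp add: coords_minus)
    moreover have "\<tau> e1 = 0" "\<tau> e2 = 0" using eI by (simp_all add: I\<tau>)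
    moreover have "coords (br e1 e2) $ 3 = 0" using derived[of e1 e2] by (simp add: I3)
    ultimately show "coords (br e1 e2) = coords 0"
      by (simp add: vec_eq_iff forall_3 coords_zero)
  qed
  have br1_I: "br1 a x \<in> I" if "x \<in> I" for a x using ab that by (simp add: abelian_ideal_def)
  define A :: "'k^2^2" where "A = vector [vector [coords (br (b 3) (b 1)) $ 1, coords (br (b 3) (b 1)) $ 2],
      vector [coords (br (b 3) (b 2)) $ 1, coords (br (b 3) (b 2)) $ 2]]"
  define B :: "'k^2^2" where "B = vector [vector [coords (br1 (b 3) (b 1)) $ 1, coords (br1 (b 3) (b 1)) $ 2],
      vector [coords (br1 (b 3) (b 2)) $ 1, coords (br1 (b 3) (b 2)) $ 2]]"
  have mA: "bracket_matrix br A"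
    unfolding A_def using derived I3 by (intro bracket_matrixI lie) (auto simp: b br12)
  have mB: "bracket_matrix br1 B"
    unfolding B_def using br1_I eI I3 ab by (intro bracket_matrixI lie) (auto simp: b abelian_ideal_def)
  have "trace A = \<tau> u" by (simp add: trace A_def trace_def sum_2 sum_3 b L(3) coords_zero)
  moreover have "trace B = endo_trace sc (br1 u)"
    by (simp add: endo_trace_coords[OF L1(1)] B_def trace_def sum_2 sum_3 b L1(3) coords_zero)
  moreover have "endo_trace sc (br1 u) = 0"
    using uni(2) by (auto simp: unimodular_def unimodular_ideal_def)
  moreover have "B \<noteq> 0"
  proof
    assume "B = 0"
    then have "coords (br1 x y) = coords 0" for x y
      using mB by (simp add: bracket_matrix_def Let_def coords_zero vec_eq_iff forall_3)
    then have "br1 = (\<lambda>a b. 0)" using coords_eqI by blast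
    then show False using assms(7) by simp
  qed
  ultimately show thesis
    using that[OF frame3_axioms b(3) I3 mA mB] \<tau>u by simp
qed

section \<open>Genericity, flatness and eigenvectors\<close>

lemma (in frame3) lie_poisson_bivector:
  assumes "bracket_matrix br A" "p \<in> dual_space sc"
  shows "lie_poisson br p a c = bivector A (linear_coords b p) (coords a) (coords c)"
proof -
  have "p (br a c) = (\<Sum>i\<in>UNIV. coords (br a c) $ i * p (b i))"
    by (rule functional_coords) (use assms(2) in \<open>simp add: dual_space_def\<close>)
  then show ?thesis
    using assms(1)
    by (simp add: lie_poisson_def bracket_matrix_def Let_def sum_3 bivector_def base_point_simps
        linear_coords_def algebra_simps)
qed

text \<open>By the chain rule the Jacobian of the inverse is a left inverse matrix.\<close>

lemma diffeomorphism_jacobian_nonsingular: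
  fixes \<phi> :: "'k::real_normed_field ^ 'n \<Rightarrow> 'k ^ 'n"
  assumes "diffeomorphism_on U \<phi>" "x \<in> U" "\<And>k. has_gradient (\<lambda>x. \<phi> x $ k) (J $ k) x"
  shows "det J \<noteq> 0"
proof -
  define \<psi> where "\<psi> = the_inv_into U \<phi>"
  have D: "open U" "inj_on \<phi> U" "\<And>k. smooth_on (\<phi> ` U) (\<lambda>y. \<psi> y $ k)"
    using assms(1) by (auto simp: diffeomorphism_on_def \<psi>_def)
  have \<psi>\<phi>: "\<psi> (\<phi> y) = y" if "y \<in> U" for y
    using D(2) that by (simp add: \<psi>_def the_inv_into_f_f)
  have "(\<chi> i. gradient (\<lambda>y. \<psi> y $ i) (\<phi> x)) ** J = mat 1"
  proof -
    have "(\<chi> j. \<Sum>l\<in>UNIV. gradient (\<lambda>y. \<psi> y $ i) (\<phi> x) $ l * J $ l $ j) = axis i 1" for i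
    proof (rule has_gradient_unique)
      show "has_gradient (\<lambda>x. \<psi> (\<phi> x) $ i)
        (\<chi> j. \<Sum>l\<in>UNIV. gradient (\<lambda>y. \<psi> y $ i) (\<phi> x) $ l * J $ l $ j) x"
        using smooth_on_gradient(1)[OF D(3)] assms(2,3)
        by (intro has_gradient_vec_compose[of "\<lambda>y. \<psi> y $ i" _ \<phi>]) auto
      show "has_gradient (\<lambda>x. \<psi> (\<phi> x) $ i) (axis i 1) x"
        by (rule has_gradient_cong_open[OF has_gradient_component D(1) assms(2)]) (simp add: \<psi>\<phi>)
    qed
    then show ?thesis
      by (auto simp: vec_eq_iff matrix_matrix_mult_def mat_def axis_def)
  qed
  then show ?thesis by (metis invertible_det_nz invertible_left_inverse invertible_right_inverse matrix_left_right_inverse)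
qed

text \<open>The pencil vanishes at \<open>p\<close> for \<open>(s, t)\<close> if and only if \<open>s X + t Y = 0\<close>, and over the complex numbers this has
  a non-trivial solution exactly if \<open>Q = det (X, Y)\<close> is zero.\<close>

lemma generic_at_iff:
  fixes sc :: "'k::field \<Rightarrow> 'a::ab_group_add \<Rightarrow> 'a"
  assumes "frame3 sc b" and mA: "frame3.bracket_matrix sc b br A" and mB: "frame3.bracket_matrix sc b br1 B"
    and p: "p \<in> dual_space sc"
    and \<iota>: "\<And>x y. \<iota> (x + y) = \<iota> x + \<iota> y" "\<And>x y. \<iota> (x * y) = \<iota> x * \<iota> y" "\<And>x. \<iota> x = 0 \<longleftrightarrow> x = 0"
  shows "generic_at \<iota> (lie_poisson br) (lie_poisson br1) p \<longleftrightarrow> pencil_det A B (linear_coords b p) \<noteq> 0"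
proof -
  interpret frame3 sc b by fact
  define X Y where "X = A *v base_point (linear_coords b p)" and "Y = B *v base_point (linear_coords b p)"
  have \<iota>0: "\<iota> 0 = 0" using \<iota>(3) by blast
  have \<iota>m: "\<iota> (- x) = - \<iota> x" for x
    using \<iota>(1)[of x "- x"] by (simp add: \<iota>0 eq_neg_iff_add_eq_0 add.commute)
  have lp: "lie_poisson br p a c = (coords a $ 3 * coords c $ 1 - coords a $ 1 * coords c $ 3) * X $ 1
      + (coords a $ 3 * coords c $ 2 - coords a $ 2 * coords c $ 3) * X $ 2"
    "lie_poisson br1 p a c = (coords a $ 3 * coords c $ 1 - coords a $ 1 * coords c $ 3) * Y $ 1
      + (coords a $ 3 * coords c $ 2 - coords a $ 2 * coords c $ 3) * Y $ 2" for a c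
    using lie_poisson_bivector[OF mA p] lie_poisson_bivector[OF mB p]
    by (simp_all add: bivector_def X_def Y_def)
  have vanish: "(\<forall>a c. s * \<iota> (lie_poisson br p a c) + t * \<iota> (lie_poisson br1 p a c) = 0) \<longleftrightarrow>
      (\<forall>i. s * \<iota> (X $ i) + t * \<iota> (Y $ i) = 0)" for s t
  proof
    assume *: "\<forall>a c. s * \<iota> (lie_poisson br p a c) + t * \<iota> (lie_poisson br1 p a c) = 0"
    have "s * \<iota> (X $ 1) + t * \<iota> (Y $ 1) = 0" "s * \<iota> (X $ 2) + t * \<iota> (Y $ 2) = 0"
      using *[rule_format, of "b 3" "b 1"] *[rule_format, of "b 3" "b 2"]
      by (simp_all add: lp coords_basis axis_def)
    then show "\<forall>i. s * \<iota> (X $ i) + t * \<iota> (Y $ i) = 0" by (simp add: forall_2)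
  next
    assume *: "\<forall>i. s * \<iota> (X $ i) + t * \<iota> (Y $ i) = 0"
    have "s * \<iota> (m * X $ 1 + n * X $ 2) + t * \<iota> (m * Y $ 1 + n * Y $ 2)
        = \<iota> m * (s * \<iota> (X $ 1) + t * \<iota> (Y $ 1)) + \<iota> n * (s * \<iota> (X $ 2) + t * \<iota> (Y $ 2))" for m n
      by (simp add: \<iota> algebra_simps)
    then show "\<forall>a c. s * \<iota> (lie_poisson br p a c) + t * \<iota> (lie_poisson br1 p a c) = 0"
      using * by (simp add: lp)
  qed
  have Q: "pencil_det A B (linear_coords b p) = X $ 1 * Y $ 2 - X $ 2 * Y $ 1"
    by (simp add: det_pairing_def wedge_def X_def Y_def)
  have \<iota>Q: "\<iota> (X $ 1 * Y $ 2 - X $ 2 * Y $ 1) = \<iota> (X $ 1) * \<iota> (Y $ 2) - \<iota> (X $ 2) * \<iota> (Y $ 1)"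
    using \<iota>(1)[of "X $ 1 * Y $ 2" "- (X $ 2 * Y $ 1)"] by (simp add: \<iota>(2) \<iota>m)
  have "generic_at \<iota> (lie_poisson br) (lie_poisson br1) p \<longleftrightarrow>
     (\<forall>s t. (\<forall>i. s * \<iota> (X $ i) + t * \<iota> (Y $ i) = 0) \<longrightarrow> s = 0 \<and> t = 0)"
    unfolding generic_at_def vanish[symmetric] by (intro iff_allI) (simp only: prod.inject, blast)
  also have "\<dots> \<longleftrightarrow> \<iota> (X $ 1) * \<iota> (Y $ 2) - \<iota> (X $ 2) * \<iota> (Y $ 1) \<noteq> 0" (is "?L \<longleftrightarrow> ?d \<noteq> 0")
  proof
    assume L0: ?L
    have L: "s = 0 \<and> t = 0" if "s * \<iota> (X $ 1) + t * \<iota> (Y $ 1) = 0" "s * \<iota> (X $ 2) + t * \<iota> (Y $ 2) = 0" for s t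
      using L0[unfolded forall_2] that by blast
    show "?d \<noteq> 0"
    proof
      assume d: "?d = 0"
      have "\<iota> (Y $ 1) = 0 \<and> - \<iota> (X $ 1) = 0" using d by (intro L) (simp_all add: algebra_simps)
      moreover have "\<iota> (Y $ 2) = 0 \<and> - \<iota> (X $ 2) = 0" using d by (intro L) (simp_all add: algebra_simps)
      ultimately show False using L[of 1 1] by simp
    qed
  next
    assume d: "?d \<noteq> 0"
    show ?L
    proof (intro allI impI)
      fix s t assume *: "\<forall>i. s * \<iota> (X $ i) + t * \<iota> (Y $ i) = 0"
      then have e: "s * \<iota> (X $ 1) + t * \<iota> (Y $ 1) = 0" "s * \<iota> (X $ 2) + t * \<iota> (Y $ 2) = 0" by auto
      have "s * ?d = \<iota> (Y $ 2) * (s * \<iota> (X $ 1) + t * \<iota> (Y $ 1)) - \<iota> (Y $ 1) * (s * \<iota> (X $ 2) + t * \<iota> (Y $ 2))"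
        "t * ?d = \<iota> (X $ 1) * (s * \<iota> (X $ 2) + t * \<iota> (Y $ 2)) - \<iota> (X $ 2) * (s * \<iota> (X $ 1) + t * \<iota> (Y $ 1))"
        by (simp_all add: algebra_simps)
      then show "s = 0 \<and> t = 0" using d unfolding e by simp
    qed
  qed
  finally show ?thesis unfolding Q \<iota>Q[symmetric] \<iota>(3) .
qed

text \<open>The flat coordinates may refer to any basis. Composing them with the linear change of coordinates to
  the adapted frame gives functions with the same differentials, to which the previous analysis applies.\<close>

lemma flat_at_imp_obstruction:
  fixes sc :: "'k::{real_normed_field,euclidean_space} \<Rightarrow> 'a::ab_group_add \<Rightarrow> 'a"
  assumes "frame3 sc b" and mA: "frame3.bracket_matrix sc b br A" and mB: "frame3.bracket_matrix sc b br1 B"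
    and tr: "trace A \<noteq> 0" "trace B = 0"
    and Q: "pencil_det A B (linear_coords b p) \<noteq> 0" and p: "p \<in> dual_space sc"
    and flat: "flat_at sc (lie_poisson br) (lie_poisson br1) p"
  shows "obstruction A B q = 0"
proof -
  interpret frame3 sc b by fact
  obtain b' :: "3 \<Rightarrow> 'a" and U' \<phi> where ob': "ordered_basis sc b'" and pU: "linear_coords b' p \<in> U'"
    and diff: "diffeomorphism_on U' \<phi>"
    and cA: "constant_coefficients sc b' U' \<phi> (lie_poisson br)"
    and cB: "constant_coefficients sc b' U' \<phi> (lie_poisson br1)"
    using flat unfolding flat_at_def by (elim exE conjE) (rule that)
  interpret b': frame sc b' by unfold_locales (rule ob')
  define T :: "'k^3^3" where "T = (\<chi> i j. coords (b' i) $ j)"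
  define S :: "'k^3^3" where "S = (\<chi> i j. b'.coords (b i) $ j)"
  have lc: "linear_coords b' r = T *v linear_coords b r" if "r \<in> dual_space sc" for r
  proof -
    have "r (b' i) = (\<Sum>j\<in>UNIV. coords (b' i) $ j * r (b j))" for i
      by (rule functional_coords) (use that in \<open>simp add: dual_space_def\<close>)
    then show ?thesis
      by (simp add: vec_eq_iff linear_coords_def matrix_vector_mult_def T_def)
  qed
  have "S ** T = mat 1"
  proof -
    have "(\<Sum>k\<in>UNIV. b'.coords a $ k * coords (b' k) $ j) = coords a $ j" for a j
    proof -
      have "coords (\<Sum>k\<in>UNIV. sc (b'.coords a $ k) (b' k)) $ j = coords a $ j"
        by (simp only: b'.coords_expand)
      then show ?thesis by (simp add: coords_sum coords_scale)
    qed
    then show ?thesis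
      by (auto simp: vec_eq_iff matrix_matrix_mult_def S_def T_def coords_basis mat_def axis_def)
  qed
  then have "det S * det T = 1" by (metis det_I det_mul)
  then have detT: "det T \<noteq> 0" by auto
  define U where "U = (\<lambda>x. T *v x) -` U'"
  have contT: "continuous_on UNIV (\<lambda>x. T *v x)"
  proof -
    have "continuous_on UNIV (\<lambda>x. (T *v x) $ i)" for i
      unfolding matrix_vector_mult_def by (auto intro!: continuous_intros)
    then show ?thesis by (simp add: continuous_on_def tendsto_vec_nth vec_tendstoI)
  qed
  have U: "open U" using diff contT unfolding U_def diffeomorphism_on_def by (auto intro: open_vimage)
  have xU: "linear_coords b p \<in> U" using pU lc[OF p] by (simp add: U_def)
  define \<Phi> where "\<Phi> k x = \<phi> (T *v x) $ k" for k x
  define G where "G k y = gradient (\<lambda>y. \<phi> y $ k) y" for k y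
  define J where "J x = (\<chi> k. G k (T *v x)) ** T" for x
  have sm\<phi>: "smooth_on U' (\<lambda>x. \<phi> x $ k)" for k using diff by (simp add: diffeomorphism_on_def)
  have gG: "has_gradient (\<lambda>x. \<phi> x $ k) (G k y) y" if "y \<in> U'" for y k
    using smooth_on_gradient(1)[OF sm\<phi> that] by (simp add: G_def)
  have gT: "has_gradient (\<lambda>x. (T *v x) $ i) (T $ i) x" for i x
    unfolding matrix_vector_mult_def has_gradient_def
    by (auto intro!: derivative_eq_intros has_derivative_nth)
  have smT: "Ck_on r V (\<lambda>x. (T *v x) $ i)" for r V i
    unfolding matrix_vector_mult_def by (auto intro!: Ck_on_sum Ck_on_mult Ck_on_const Ck_on_component)
  have sm\<Phi>: "smooth_on U (\<Phi> k)" for k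
    unfolding smooth_on_def \<Phi>_def
    by (intro allI Ck_on_vec_compose[OF _ smT, of _ U']) (use sm\<phi> in \<open>auto simp: smooth_on_def U_def\<close>)
  have g\<Phi>: "has_gradient (\<Phi> k) (J x $ k) x" if "x \<in> U" for x k
  proof (rule has_gradient_eq)
    show "has_gradient (\<Phi> k) (\<chi> j. \<Sum>i\<in>UNIV. G k (T *v x) $ i * T $ i $ j) x"
      unfolding \<Phi>_def using that by (intro has_gradient_vec_compose[OF gG gT]) (simp add: U_def)
  qed (simp add: J_def matrix_matrix_mult_def)
  have det: "det (J x) \<noteq> 0" if "x \<in> U" for x
    using diffeomorphism_jacobian_nonsingular[OF diff, of "T *v x" "\<chi> k. G k (T *v x)"] gG that detT
    by (simp add: J_def det_mul U_def)
  have coords_differential: "coords (differential sc b' (\<lambda>y. \<phi> y $ k) r) = J (linear_coords b r) $ k"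
    if "r \<in> dual_space sc" for r k
    by (simp add: differential_def coords_sum coords_scale lc[OF that] J_def G_def matrix_matrix_mult_def
        vec_eq_iff T_def)
  have const: "\<exists>c. \<forall>y\<in>U. bivector M y (J y $ i) (J y $ j) = c"
    if M: "bracket_matrix br' M" and cM: "constant_coefficients sc b' U' \<phi> (lie_poisson br')" for M br' i j
  proof -
    obtain c where c: "\<forall>r\<in>dual_space sc. linear_coords b' r \<in> U' \<longrightarrow>
      lie_poisson br' r (differential sc b' (\<lambda>x. \<phi> x $ i) r) (differential sc b' (\<lambda>x. \<phi> x $ j) r) = c"
      using spec[OF spec[OF cM[unfolded constant_coefficients_def], of i], of j] by (elim exE) (rule that)
    have "bivector M y (J y $ i) (J y $ j) = c" if "y \<in> U" for y
      using bspec[OF c point_dual, of y] that lc[OF point_dual]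
      by (simp add: lie_poisson_bivector[OF M point_dual] coords_differential[OF point_dual] linear_coords_point U_def)
    then show ?thesis by blast
  qed
  obtain c where c: "\<And>i j y. y \<in> U \<Longrightarrow> bivector A y (J y $ i) (J y $ j) = c i j"
    using const[OF mA cA] by metis
  obtain c1 where c1: "\<And>i j y. y \<in> U \<Longrightarrow> bivector B y (J y $ i) (J y $ j) = c1 i j"
    using const[OF mB cB] by metis
  show ?thesis
    by (rule constant_coefficients_obstruction[OF U xU Q tr sm\<Phi> g\<Phi> det c c1])
qed

lemma obstruction_zero_imp_flat_at:
  fixes sc :: "'k::{real_normed_field,euclidean_space} \<Rightarrow> 'a::ab_group_add \<Rightarrow> 'a"
  assumes "frame3 sc b" and mA: "frame3.bracket_matrix sc b br A" and mB: "frame3.bracket_matrix sc b br1 B"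
    and tr: "trace B = 0"
    and Q: "pencil_det A B (linear_coords b p) \<noteq> 0"
    and ob: "\<And>q. obstruction A B q = 0"
  shows "flat_at sc (lie_poisson br) (lie_poisson br1) p"
proof -
  interpret frame3 sc b by fact
  obtain V \<phi> J where V: "linear_coords b p \<in> V" "diffeomorphism_on V \<phi>"
    and J: "\<And>x k. x \<in> V \<Longrightarrow> has_gradient (\<lambda>x. \<phi> x $ k) (J x $ k) x"
    and cA: "\<And>i j. \<exists>c. \<forall>x\<in>V. bivector A x (J x $ i) (J x $ j) = c"
    and cB: "\<And>i j. \<exists>c. \<forall>x\<in>V. bivector B x (J x $ i) (J x $ j) = c"
    using flat_coordinates_exist[OF Q tr ob] by blast
  have dif: "coords (differential sc b (\<lambda>x. \<phi> x $ k) r) = J (linear_coords b r) $ k"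
    if "linear_coords b r \<in> V" for r k
    by (simp add: differential_def gradient_eq[OF J[OF that]] coords_combination)
  have "constant_coefficients sc b V \<phi> (lie_poisson br')"
    if "bracket_matrix br' M" and c: "\<And>i j. \<exists>c. \<forall>x\<in>V. bivector M x (J x $ i) (J x $ j) = c" for br' M
    unfolding constant_coefficients_def
  proof (intro allI)
    fix i j
    obtain c where "\<forall>x\<in>V. bivector M x (J x $ i) (J x $ j) = c" using c by blast
    then show "\<exists>c. \<forall>p\<in>dual_space sc. linear_coords b p \<in> V \<longrightarrow>
        lie_poisson br' p (differential sc b (\<lambda>x. \<phi> x $ i) p) (differential sc b (\<lambda>x. \<phi> x $ j) p) = c"
      by (intro exI[of _ c]) (simp add: lie_poisson_bivector[OF that(1)] dif)
  qed
  then show ?thesis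
    unfolding flat_at_def using ordered_basis V mA mB cA cB by (intro exI conjI) auto
qed

text \<open>The obstruction is the polarisation of the quadratic form \<open>det_pairing A B\<close> at the pair \<open>q\<close>, \<open>B q\<close>.\<close>

lemma det_pairing_zero_imp_obstruction:
  assumes "\<And>q. det_pairing A B q = 0"
  shows "obstruction A B q = 0"
proof -
  have "det_pairing A B (q + B *v q) = det_pairing A B q + obstruction A B q + det_pairing A B (B *v q)"
    by (simp add: det_pairing_def obstruction_def matrix_vector_right_distrib wedge_simps)
  then show ?thesis by (simp add: assms)
qed

text \<open>Flatness at one generic point forces the obstruction to vanish identically, and then the pair is flat
  at all generic points; and a non-zero obstruction provides a generic point by itself.\<close>

theorem generic_nonflat_iff_obstruction:
  fixes sc :: "'k::{real_normed_field,euclidean_space} \<Rightarrow> 'a::ab_group_add \<Rightarrow> 'a"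
  assumes fr: "frame3 sc b" and mA: "frame3.bracket_matrix sc b br A" and mB: "frame3.bracket_matrix sc b br1 B"
    and tr: "trace A \<noteq> 0" "trace B = 0"
    and \<iota>: "\<And>x y. \<iota> (x + y) = \<iota> x + \<iota> y" "\<And>x y. \<iota> (x * y) = \<iota> x * \<iota> y" "\<And>x. \<iota> x = 0 \<longleftrightarrow> x = 0"
  shows "generic_pair \<iota> sc (lie_poisson br) (lie_poisson br1) \<and> \<not> flat_pair \<iota> sc (lie_poisson br) (lie_poisson br1)
    \<longleftrightarrow> (\<exists>q. obstruction A B q \<noteq> 0)"
proof
  interpret frame3 sc b by (rule fr)
  note gen = generic_at_iff[OF fr mA mB _ \<iota>]
  {
    assume "generic_pair \<iota> sc (lie_poisson br) (lie_poisson br1) \<and> \<not> flat_pair \<iota> sc (lie_poisson br) (lie_poisson br1)"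
    then obtain p where p: "p \<in> dual_space sc" "pencil_det A B (linear_coords b p) \<noteq> 0"
      "\<not> flat_at sc (lie_poisson br) (lie_poisson br1) p"
      using gen by (auto simp: flat_pair_def)
    then show "\<exists>q. obstruction A B q \<noteq> 0"
      using obstruction_zero_imp_flat_at[OF fr mA mB tr(2) p(2)] by blast
  next
    assume ob: "\<exists>q. obstruction A B q \<noteq> 0"
    then obtain q where q: "det_pairing A B q \<noteq> 0" using det_pairing_zero_imp_obstruction by blast
    define p where "p = point (vector [q $ 1, q $ 2, 0])"
    have "base_point (linear_coords b p) = q"
      by (simp add: p_def linear_coords_point base_point_def vec_eq_iff forall_2)
    then have p: "p \<in> dual_space sc" "pencil_det A B (linear_coords b p) \<noteq> 0"
      using q by (simp_all add: p_def point_dual)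
    then have "generic_at \<iota> (lie_poisson br) (lie_poisson br1) p" using gen by simp
    moreover have "\<not> flat_at sc (lie_poisson br) (lie_poisson br1) p"
      using flat_at_imp_obstruction[OF fr mA mB tr p(2,1)] ob by blast
    ultimately show "generic_pair \<iota> sc (lie_poisson br) (lie_poisson br1) \<and> \<not> flat_pair \<iota> sc (lie_poisson br) (lie_poisson br1)"
      using p(1) by (auto simp: generic_pair_def flat_pair_def)
  }
qed

lemma obstruction_zero_iff:
  "(\<forall>q. obstruction A B q = 0) \<longleftrightarrow> obstruction A B (vector [1, 0]) = 0 \<and> obstruction A B (vector [0, 1]) = 0
     \<and> obstruction A B (vector [1, 1]) = 0"
proof -
  have "obstruction A B q = 0" if "obstruction A B (vector [1, 0]) = 0" "obstruction A B (vector [0, 1]) = 0"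
     "obstruction A B (vector [1, 1]) = 0" for q
    by (subst quadratic_obstruction) (simp add: that)
  then show ?thesis by blast
qed

text \<open>The rows of \<open>A\<close> are the images of the basis vectors, so on coordinates of vectors of the ideal the
  endomorphism acts by the transpose of \<open>A\<close>.\<close>

lemma (in frame3) bracket_transpose_coords:
  assumes "bracket_matrix br A" "coords w $ 3 = 0"
  shows "coords (br (b 3) w) $ 3 = 0" "base_point (coords (br (b 3) w)) = transpose A *v base_point (coords w)"
  using assms
  by (simp_all add: bracket_matrix_def Let_def coords_basis axis_def base_point_def plane_simps mult.commute)

lemma eigenvectors_iff_obstruction:
  fixes A B :: "complex ^ 2 ^ 2"
  assumes "trace B = 0" "B \<noteq> 0"
  shows "(\<exists>z. z \<noteq> 0 \<and> (\<exists>l. transpose B *v z = l *s z) \<and> \<not> (\<exists>l. transpose A *v z = l *s z))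
     \<longleftrightarrow> (\<exists>q. obstruction A B q \<noteq> 0)"
proof -
  have "trace (transpose B) = 0" using assms(1) by (simp add: trace_def transpose_def)
  moreover have "transpose B \<noteq> 0" using assms(2) by (auto simp: transpose_def vec_eq_iff)
  ultimately show ?thesis
    using common_eigenvectors_iff[of "transpose B" "transpose A"] obstruction_transpose_eq_0_iff[OF assms(1), of A]
    by blast
qed

lemma generic_nonflat_iff_eigenvector_complex:
  fixes sc :: "complex \<Rightarrow> 'a::ab_group_add \<Rightarrow> 'a"
  assumes "vector_space sc" "vector_space.dim sc UNIV = 3"
    "lie_bracket sc br" "lie_bracket sc br1" "\<not> unimodular sc br" "unimodular sc br1" "br1 \<noteq> (\<lambda>a b. 0)"
    "I = unimodular_ideal sc br" "abelian_ideal sc br1 I" "u \<notin> I"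
  shows "compatible_brackets sc br br1 \<and>
      (generic_pair id sc (lie_poisson br) (lie_poisson br1) \<and>
       \<not> flat_pair id sc (lie_poisson br) (lie_poisson br1) \<longleftrightarrow>
       (\<exists>w. eigenvector_on sc I (br1 u) w \<and> \<not> eigenvector_on sc I (br u) w))"
proof -
  obtain b A B where fr: "frame3 sc b" and b3: "b 3 = u" and I: "I = {a. frame.coords sc b a $ 3 = 0}"
    and m: "frame3.bracket_matrix sc b br A" "frame3.bracket_matrix sc b br1 B"
    and tr: "trace A \<noteq> 0" "trace B = 0" "B \<noteq> 0"
    using adapted_frame_exists[OF assms] .
  interpret frame3 sc b by (rule fr)
  have ev: "eigenvector_on sc I (br' u) w \<longleftrightarrow> w \<in> I \<and> base_point (coords w) \<noteq> 0
      \<and> (\<exists>l. transpose M *v base_point (coords w) = l *s base_point (coords w))"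
    if "bracket_matrix br' M" for br' M w
  proof (cases "w \<in> I")
    case True
    then have w: "coords w $ 3 = 0" by (simp add: I)
    have eq: "x = y \<longleftrightarrow> base_point (coords x) = base_point (coords y)"
      if "coords x $ 3 = 0" "coords y $ 3 = 0" for x y
      using that coords_eqI[of x y] by (auto simp: vec_eq_iff forall_3 forall_2 base_point_def)
    have "base_point (coords (sc l w)) = l *s base_point (coords w)" "base_point (coords 0) = 0" for l
      by (simp_all add: vec_eq_iff forall_2 base_point_def coords_scale coords_zero)
    then show ?thesis
      using True eq[of w 0] eq[of "br' u w" "sc _ w"] bracket_transpose_coords[OF that w]
      by (simp add: eigenvector_on_def b3 w coords_scale coords_zero)
  qed (simp add: eigenvector_on_def)
  have "(\<exists>w. eigenvector_on sc I (br1 u) w \<and> \<not> eigenvector_on sc I (br u) w) \<longleftrightarrow>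
    (\<exists>z. z \<noteq> 0 \<and> (\<exists>l. transpose B *v z = l *s z) \<and> \<not> (\<exists>l. transpose A *v z = l *s z))"
  proof -
    have "\<exists>w\<in>I. base_point (coords w) = z" for z
    proof
      let ?w = "\<Sum>i\<in>UNIV. sc (vector [z $ 1, z $ 2, 0] $ i) (b i)"
      show "?w \<in> I" "base_point (coords ?w) = z"
        by (simp_all add: I coords_combination base_point_def vec_eq_iff forall_2)
    qed
    then show ?thesis unfolding ev[OF m(1)] ev[OF m(2)] by metis
  qed
  also have "\<dots> \<longleftrightarrow> (\<exists>q. obstruction A B q \<noteq> 0)" by (rule eigenvectors_iff_obstruction[OF tr(2,3)])
  finally show ?thesis
    using generic_nonflat_iff_obstruction[OF fr m tr(1,2), of id] compatible_of_matrices[OF assms(3,4) m]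
    by simp
qed

text \<open>A quadratic form is determined by its values at three real vectors.\<close>

lemma obstruction_of_real:
  fixes A B :: "real ^ 2 ^ 2"
  shows "(\<forall>z. obstruction (\<chi> i j. complex_of_real (A $ i $ j)) (\<chi> i j. complex_of_real (B $ i $ j)) z = 0)
    \<longleftrightarrow> (\<forall>q. obstruction A B q = 0)"
proof -
  have "obstruction (\<chi> i j. complex_of_real (A $ i $ j)) (\<chi> i j. complex_of_real (B $ i $ j))
      (vector [of_real x, of_real y]) = of_real (obstruction A B (vector [x, y]))" for x y
    by (simp add: obstruction_def plane_simps)
  from this[of 1 0] this[of 0 1] this[of 1 1] show ?thesis
    unfolding obstruction_zero_iff by simp
qed

lemma generic_nonflat_iff_eigenvector_real:
  fixes sc :: "real \<Rightarrow> 'a::ab_group_add \<Rightarrow> 'a"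
  assumes "vector_space sc" "vector_space.dim sc UNIV = 3"
    "lie_bracket sc br" "lie_bracket sc br1" "\<not> unimodular sc br" "unimodular sc br1" "br1 \<noteq> (\<lambda>a b. 0)"
    "I = unimodular_ideal sc br" "abelian_ideal sc br1 I" "u \<notin> I"
  shows "compatible_brackets sc br br1 \<and>
      (generic_pair complex_of_real sc (lie_poisson br) (lie_poisson br1) \<and>
       \<not> flat_pair complex_of_real sc (lie_poisson br) (lie_poisson br1) \<longleftrightarrow>
       (\<exists>w. eigenvector_on (complexify_scale sc) (I \<times> I) (map_prod (br1 u) (br1 u)) w \<and>
            \<not> eigenvector_on (complexify_scale sc) (I \<times> I) (map_prod (br u) (br u)) w))"
proof -
  obtain b A B where fr: "frame3 sc b" and b3: "b 3 = u" and I: "I = {a. frame.coords sc b a $ 3 = 0}"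
    and m: "frame3.bracket_matrix sc b br A" "frame3.bracket_matrix sc b br1 B"
    and tr: "trace A \<noteq> 0" "trace B = 0" "B \<noteq> 0"
    using adapted_frame_exists[OF assms] .
  interpret frame3 sc b by (rule fr)
  define cx :: "real^2^2 \<Rightarrow> complex^2^2" where "cx M = (\<chi> i j. complex_of_real (M $ i $ j))" for M
  define ccoords :: "'a \<times> 'a \<Rightarrow> complex ^ 2" where
    "ccoords w = (\<chi> i. Complex (base_point (coords (fst w)) $ i) (base_point (coords (snd w)) $ i))" for w
  have eq: "x = y \<longleftrightarrow> ccoords x = ccoords y"
    if "coords (fst x) $ 3 = 0" "coords (fst y) $ 3 = 0" "coords (snd x) $ 3 = 0" "coords (snd y) $ 3 = 0" for x y
    using that coords_eqI[of "fst x" "fst y"] coords_eqI[of "snd x" "snd y"]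
    by (auto simp: prod_eq_iff vec_eq_iff forall_3 forall_2 base_point_def ccoords_def)
  have cs: "ccoords (complexify_scale sc l w) = l *s ccoords w" for l w
    by (simp add: complexify_scale_def ccoords_def vec_eq_iff forall_2 base_point_def complex_eq_iff
        coords_add coords_diff coords_scale)
  have cz: "ccoords 0 = 0"
    by (simp add: ccoords_def vec_eq_iff forall_2 base_point_def complex_eq_iff coords_zero)
  have ev: "eigenvector_on (complexify_scale sc) (I \<times> I) (map_prod (br' u) (br' u)) w \<longleftrightarrow> w \<in> I \<times> I \<and> ccoords w \<noteq> 0
      \<and> (\<exists>l. transpose (cx M) *v ccoords w = l *s ccoords w)"
    if mM: "bracket_matrix br' M" for br' M w
  proof (cases "w \<in> I \<times> I")
    case True
    then have w: "coords (fst w) $ 3 = 0" "coords (snd w) $ 3 = 0" by (auto simp: I)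
    note T = bracket_transpose_coords[OF mM w(1)] bracket_transpose_coords[OF mM w(2)]
    have "ccoords (map_prod (br' u) (br' u) w) = transpose (cx M) *v ccoords w"
      using T(2,4) by (simp add: ccoords_def b3 cx_def map_prod_def case_prod_beta plane_simps complex_eq_iff)
    moreover have "map_prod (br' u) (br' u) w = complexify_scale sc l w
        \<longleftrightarrow> ccoords (map_prod (br' u) (br' u) w) = ccoords (complexify_scale sc l w)" for l
      by (rule eq) (use T(1,3) w in \<open>simp_all add: b3 map_prod_def case_prod_beta complexify_scale_def
            coords_add coords_diff coords_scale\<close>)
    moreover have "w = 0 \<longleftrightarrow> ccoords w = 0"
      using eq[of w 0] w by (simp add: cz coords_zero)
    ultimately show ?thesis
      using True by (simp add: eigenvector_on_def cs)
  qed (simp add: eigenvector_on_def)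
  have "(\<exists>w. eigenvector_on (complexify_scale sc) (I \<times> I) (map_prod (br1 u) (br1 u)) w \<and>
            \<not> eigenvector_on (complexify_scale sc) (I \<times> I) (map_prod (br u) (br u)) w) \<longleftrightarrow>
    (\<exists>z. z \<noteq> 0 \<and> (\<exists>l. transpose (cx B) *v z = l *s z) \<and> \<not> (\<exists>l. transpose (cx A) *v z = l *s z))"
  proof -
    have "\<exists>w\<in>I \<times> I. ccoords w = z" for z
    proof
      let ?v = "\<lambda>f. \<Sum>i\<in>UNIV. sc (vector [f (z $ 1), f (z $ 2), 0] $ i) (b i)"
      show "(?v Re, ?v Im) \<in> I \<times> I" "ccoords (?v Re, ?v Im) = z"
        by (simp_all add: I coords_combination ccoords_def base_point_def vec_eq_iff forall_2)
    qed
    then show ?thesis unfolding ev[OF m(1)] ev[OF m(2)] by metis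
  qed
  also have "\<dots> \<longleftrightarrow> (\<exists>q. obstruction (cx A) (cx B) q \<noteq> 0)"
  proof (rule eigenvectors_iff_obstruction)
    show "trace (cx B) = 0"
      using tr(2) unfolding trace_def cx_def by (simp flip: of_real_sum)
    show "cx B \<noteq> 0" using tr(3) by (simp add: cx_def vec_eq_iff)
  qed
  also have "\<dots> \<longleftrightarrow> (\<exists>q. obstruction A B q \<noteq> 0)"
    using obstruction_of_real[of A B] unfolding cx_def by blast
  finally show ?thesis
    using generic_nonflat_iff_obstruction[OF fr m tr(1,2), of complex_of_real] compatible_of_matrices[OF assms(3,4) m]
    by simp
qed

theorem proposition9:
  shows
  "(\<forall>(sc :: real \<Rightarrow> 'a::ab_group_add \<Rightarrow> 'a) br br1 I u.
      vector_space sc \<and> vector_space.dim sc UNIV = 3 \<and>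
      lie_bracket sc br \<and> lie_bracket sc br1 \<and>
      \<not> unimodular sc br \<and> unimodular sc br1 \<and> br1 \<noteq> (\<lambda>a b. 0) \<and>
      I = unimodular_ideal sc br \<and> abelian_ideal sc br1 I \<and> u \<notin> I \<longrightarrow>
      compatible_brackets sc br br1 \<and>
      (generic_pair complex_of_real sc (lie_poisson br) (lie_poisson br1) \<and>
       \<not> flat_pair complex_of_real sc (lie_poisson br) (lie_poisson br1) \<longleftrightarrow>
       (\<exists>w. eigenvector_on (complexify_scale sc) (I \<times> I) (map_prod (br1 u) (br1 u)) w \<and>
            \<not> eigenvector_on (complexify_scale sc) (I \<times> I) (map_prod (br u) (br u)) w)))
   \<and>
   (\<forall>(sc :: complex \<Rightarrow> 'b::ab_group_add \<Rightarrow> 'b) br br1 I u.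
      vector_space sc \<and> vector_space.dim sc UNIV = 3 \<and>
      lie_bracket sc br \<and> lie_bracket sc br1 \<and>
      \<not> unimodular sc br \<and> unimodular sc br1 \<and> br1 \<noteq> (\<lambda>a b. 0) \<and>
      I = unimodular_ideal sc br \<and> abelian_ideal sc br1 I \<and> u \<notin> I \<longrightarrow>
      compatible_brackets sc br br1 \<and>
      (generic_pair id sc (lie_poisson br) (lie_poisson br1) \<and>
       \<not> flat_pair id sc (lie_poisson br) (lie_poisson br1) \<longleftrightarrow>
       (\<exists>w. eigenvector_on sc I (br1 u) w \<and> \<not> eigenvector_on sc I (br u) w)))"
proof (rule conjI)
  show "(\<forall>(sc :: real \<Rightarrow> 'a::ab_group_add \<Rightarrow> 'a) br br1 I u.
      vector_space sc \<and> vector_space.dim sc UNIV = 3 \<and>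
      lie_bracket sc br \<and> lie_bracket sc br1 \<and>
      \<not> unimodular sc br \<and> unimodular sc br1 \<and> br1 \<noteq> (\<lambda>a b. 0) \<and>
      I = unimodular_ideal sc br \<and> abelian_ideal sc br1 I \<and> u \<notin> I \<longrightarrow>
      compatible_brackets sc br br1 \<and>
      (generic_pair complex_of_real sc (lie_poisson br) (lie_poisson br1) \<and>
       \<not> flat_pair complex_of_real sc (lie_poisson br) (lie_poisson br1) \<longleftrightarrow>
       (\<exists>w. eigenvector_on (complexify_scale sc) (I \<times> I) (map_prod (br1 u) (br1 u)) w \<and>
            \<not> eigenvector_on (complexify_scale sc) (I \<times> I) (map_prod (br u) (br u)) w)))"
    by (intro allI impI, elim conjE) (rule generic_nonflat_iff_eigenvector_real)
  show "(\<forall>(sc :: complex \<Rightarrow> 'b::ab_group_add \<Rightarrow> 'b) br br1 I u.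
      vector_space sc \<and> vector_space.dim sc UNIV = 3 \<and>
      lie_bracket sc br \<and> lie_bracket sc br1 \<and>
      \<not> unimodular sc br \<and> unimodular sc br1 \<and> br1 \<noteq> (\<lambda>a b. 0) \<and>
      I = unimodular_ideal sc br \<and> abelian_ideal sc br1 I \<and> u \<notin> I \<longrightarrow>
      compatible_brackets sc br br1 \<and>
      (generic_pair id sc (lie_poisson br) (lie_poisson br1) \<and>
       \<not> flat_pair id sc (lie_poisson br) (lie_poisson br1) \<longleftrightarrow>
       (\<exists>w. eigenvector_on sc I (br1 u) w \<and> \<not> eigenvector_on sc I (br u) w)))"
    by (intro allI impI, elim conjE) (rule generic_nonflat_iff_eigenvector_complex)
qed

end
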